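(* Fix an integer $N\ge2$ and $0<\delta<1$. Let $K_\delta$ be a random variable with distribution $$p_{N,\delta}(k):=\mathbb P(K_\delta=k)=\frac{\binom Nk\delta^k(1-\delta)^{N-k}q_k(N)}{B_{0,\delta}},\quad k=1,\dots,N,\qquad B_{0,\delta}=\sum_{k=1}^N\binom Nk\delta^k(1-\delta)^{N-k}q_k(N),$$ where $q_k$ is the chi-square density with $k$ degrees of freedom. Then, with $\ell_a=\log(1/a)$ and $F_{a,\delta}$ the probability density on $S^{N-1}(\sqrt N)$ proportional to $\prod_{i=1}^N f_{a,\delta}(v_i)$, where $f_{a,\delta}=(1-\delta)M_a+\delta M_1$, $$\lim_{a\downarrow0}\frac{H_N(F_{a,\delta})}{\ell_a}=\frac{N-\mathbb E(K_\delta)}{2},\qquad \lim_{a\downarrow0}\frac{\mathcal D_N(F_{a,\delta},\log F_{a,\delta})}{\ell_a}=\frac{\mathbb E\bigl(K_\delta(N-K_\delta)\bigr)}{N-1}.$$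
   Context: Let $\mathbb S_N=S^{N-1}(\sqrt N)=\{v\in\mathbb R^N:\sum_{i=1}^N v_i^2=N\}$ and let $\sigma_N$ be the uniform probability measure on $\mathbb S_N$. For $1\le i<j\le N$ and $\theta\in[0,2\pi)$, $R_{ij,\theta}$ is the rotation $(v_i,v_j)\mapsto(v_i\cos\theta-v_j\sin\theta,\ v_i\sin\theta+v_j\cos\theta)$ leaving all other coordinates unchanged. For a probability density $F$ with respect to $\sigma_N$, $H_N(F)=\int_{\mathbb S_N}F\log F\,d\sigma_N$, and for strictly positive $F$ $$\mathcal D_N(F,\log F)=\frac1{N-1}\sum_{1\le i<j\le N}\int_{\mathbb S_N}\int_0^{2\pi}\bigl(F(v)-F(R_{ij,\theta}v)\bigr)\bigl(\log F(v)-\log F(R_{ij,\theta}v)\bigr)\frac{d\theta}{2\pi}\,d\sigma_N(v).$$ For $s>0$, $M_s(x)=\frac1{\sqrt{2\pi s}}e^{-x^2/(2s)}$ is the centered Gaussian density of variance $s$. For $0<a<1$ and $0<\delta<1$, $$f_{a,\delta}=(1-\delta)M_a+\delta M_1,\qquad Z_{a,\delta}=\int_{\mathbb S_N}\prod_{i=1}^Nf_{a,\delta}(v_i)\,d\sigma_N(v),\qquad F_{a,\delta}(v)=\frac{\prod_{i=1}^Nf_{a,\delta}(v_i)}{Z_{a,\delta}}.$$ For an integer $r\ge1$, $q_r(t)=\frac{t^{r/2-1}e^{-t/2}}{2^{r/2}\Gamma(r/2)}\mathbf 1_{(0,\infty)}(t)$, where $\Gamma(\cdot)$ is the gamma function.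 *)

theory Defs
  imports "HOL-Probability.Probability"
begin

(* Vectors of R^N are elements of real^'n with CARD('n) = N. The index type is taken linearly
   ordered to speak about pairs i < j; on a finite type every linear order is a well-order, and
   the class wellorder is the one used by the library's change-of-variables results. *)

definition kac_sphere :: "(real^'n) set" where
  "kac_sphere = {v. (\<Sum>i\<in>UNIV. (v $ i)\<^sup>2) = real CARD('n)}"

(* The uniform probability measure on the sphere of radius sqrt N, realised as a Borel measure
   on R^N carried by the sphere (AE_sphere_unif): the law of sqrt N * X/|X| for X uniform in the
   unit ball. It is invariant under the orthogonal group (sphere_unif_orthogonal). *)
definition sphere_unif :: "(real^'n) measure" where
  "sphere_unif = distr (uniform_measure lborel (cball 0 1)) borel
     (\<lambda>x. sqrt (real CARD('n)) *\<^sub>R sgn x)"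

definition plane_rot :: "'n \<Rightarrow> 'n \<Rightarrow> real \<Rightarrow> real^'n \<Rightarrow> real^'n" where
  "plane_rot i j \<theta> v = (\<chi> k. if k = i then v $ i * cos \<theta> - v $ j * sin \<theta>
                               else if k = j then v $ i * sin \<theta> + v $ j * cos \<theta>
                               else v $ k)"

(* Bochner integrals: an integral that does not converge absolutely is 0 by convention. The
   densities below (mix_density) are positive, continuous and bounded on the sphere, so this
   convention does not intervene for them. *)
definition sphere_entropy :: "(real^'n \<Rightarrow> real) \<Rightarrow> real" where
  "sphere_entropy F = (LINT v|sphere_unif. F v * ln (F v))"

(* D_N(F, G); the dissipation D_N(F, log F) is kac_form F (\<lambda>v. ln (F v)). *)
definition kac_form :: "(real^('n::{finite,wellorder}) \<Rightarrow> real) \<Rightarrow> (real^('n::{finite,wellorder}) \<Rightarrow> real) \<Rightarrow> real" where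
  "kac_form F G = 1 / (real CARD('n) - 1) *
     (\<Sum>(i, j)\<in>{(i, j). i < j}.
        LINT v|sphere_unif.
          (LINT \<theta>:{0..2*pi}|lborel.
             (F v - F (plane_rot i j \<theta> v)) * (G v - G (plane_rot i j \<theta> v)) / (2 * pi)))"

definition gauss :: "real \<Rightarrow> real \<Rightarrow> real" where
  "gauss s x = normal_density 0 (sqrt s) x"

definition gauss_mix :: "real \<Rightarrow> real \<Rightarrow> real \<Rightarrow> real" where
  "gauss_mix a \<delta> x = (1 - \<delta>) * gauss a x + \<delta> * gauss 1 x"

definition mix_prod :: "real \<Rightarrow> real \<Rightarrow> real^'n \<Rightarrow> real" where
  "mix_prod a \<delta> v = (\<Prod>i\<in>UNIV. gauss_mix a \<delta> (v $ i))"

definition mix_density :: "real \<Rightarrow> real \<Rightarrow> real^'n \<Rightarrow> real" where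
  "mix_density a \<delta> v = mix_prod a \<delta> v / (LINT w|(sphere_unif :: (real^'n) measure). mix_prod a \<delta> w)"

definition chi_square_density :: "nat \<Rightarrow> real \<Rightarrow> real" where
  "chi_square_density r t =
     (if t > 0 then t powr (real r / 2 - 1) * exp (- t / 2) / (2 powr (real r / 2) * Gamma (real r / 2))
      else 0)"

definition K_weight :: "nat \<Rightarrow> real \<Rightarrow> nat \<Rightarrow> real" where
  "K_weight N \<delta> k =
     real (N choose k) * \<delta> ^ k * (1 - \<delta>) ^ (N - k) * chi_square_density k (real N)"

definition K_prob :: "nat \<Rightarrow> real \<Rightarrow> nat \<Rightarrow> real" where
  "K_prob N \<delta> k = K_weight N \<delta> k / (\<Sum>m=1..N. K_weight N \<delta> m)"


lemma gauss_eq: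
  assumes "s > 0"
  shows "gauss s x = 1 / sqrt (2 * pi * s) * exp (- (x\<^sup>2) / (2 * s))"
  using assms by (simp add: gauss_def normal_density_def)

lemma norm_kac_sphere: "v \<in> kac_sphere \<longleftrightarrow> norm (v :: real^'n) = sqrt (real CARD('n))"
proof -
  have "norm v = sqrt (\<Sum>i\<in>UNIV. (v $ i)\<^sup>2)"
    by (simp add: norm_vec_def L2_set_def)
  then show ?thesis
    by (simp add: kac_sphere_def)
qed

lemma borel_measurable_sgn_vec [measurable]: "(sgn :: real^'n \<Rightarrow> real^'n) \<in> borel_measurable borel"
proof -
  have "(\<lambda>x :: real^'n. inverse (norm x) *\<^sub>R x) \<in> borel_measurable borel"
    by measurable
  then show ?thesis
    by (simp add: sgn_div_norm [abs_def])
qed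

lemma emeasure_cball_vec:
  "emeasure lborel (cball (0 :: real^'n) 1) \<noteq> 0" "emeasure lborel (cball (0 :: real^'n) 1) \<noteq> \<infinity>"
proof -
  have "emeasure lborel (cball (0 :: real^'n) 1) = ennreal (measure lborel (cball (0 :: real^'n) 1))"
    using emeasure_lborel_cball_finite[of "0 :: real^'n" 1]
    by (intro emeasure_eq_ennreal_measure) auto
  moreover have "measure lborel (cball (0 :: real^'n) 1) > 0"
    using content_cball_pos[of 1 "0 :: real^'n"] by simp
  ultimately show "emeasure lborel (cball (0 :: real^'n) 1) \<noteq> 0" 
      "emeasure lborel (cball (0 :: real^'n) 1) \<noteq> \<infinity>"
    by auto
qed

lemma sets_sphere_unif [measurable_cong, simp]: "sets sphere_unif = sets borel"
  by (simp add: sphere_unif_def)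

lemma space_sphere_unif [simp]: "space sphere_unif = UNIV"
  by (simp add: sphere_unif_def)

lemma prob_space_sphere_unif: "prob_space (sphere_unif :: (real^'n) measure)"
proof -
  interpret U: prob_space "uniform_measure lborel (cball (0 :: real^'n) 1)"
    by (rule prob_space_uniform_measure) (use emeasure_cball_vec in auto)
  show ?thesis
    unfolding sphere_unif_def by (rule U.prob_space_distr) measurable
qed

lemma AE_sphere_unif: "AE v in sphere_unif. (v :: real^'n) \<in> kac_sphere"
proof -
  have "AE x :: real^'n in lborel. x \<noteq> 0"
    by (rule AE_lborel_singleton)
  then have "AE x :: real^'n in lborel. x \<in> cball 0 1 \<longrightarrow>
      norm (sqrt (real CARD('n)) *\<^sub>R sgn x) = sqrt (real CARD('n))"
    by eventually_elim (simp add: norm_sgn)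
  then have "AE x in uniform_measure lborel (cball (0 :: real^'n) 1).
      norm (sqrt (real CARD('n)) *\<^sub>R sgn x) = sqrt (real CARD('n))"
    by (subst AE_uniform_measure) (use emeasure_cball_vec[where 'n='n] in \<open>auto simp: less_top\<close>)
  then show ?thesis
    unfolding norm_kac_sphere sphere_unif_def
    by (subst AE_distr_iff) (auto simp del: norm_scaleR)
qed

lemma sphere_unif_orthogonal:
  fixes T :: "real^'n::{finite,wellorder} \<Rightarrow> real^'n::_"
  assumes T: "orthogonal_transformation T"
  shows "distr sphere_unif borel T = sphere_unif"
proof -
  let ?B = "cball (0 :: real^'n::_) 1"
  let ?U = "uniform_measure lborel ?B"
  let ?r = "sqrt (real CARD('n))"
  have lin: "linear T" and nrm: "norm (T x) = norm x" for x
    using T by (auto simp: orthogonal_transformation)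
  have bij: "bij T"
    using T by (rule orthogonal_transformation_bij)
  have invT: "orthogonal_transformation (inv T)"
    using T by (rule orthogonal_transformation_inv)
  have meas [measurable]: "T \<in> borel_measurable borel"
    using lin by (intro borel_measurable_continuous_onI linear_continuous_on)
                 (simp add: linear_conv_bounded_linear)
  have vim: "emeasure lborel (?B \<inter> T -` A) = emeasure lborel (?B \<inter> A)" if A: "A \<in> sets borel" for A
  proof -
    have eq: "?B \<inter> T -` A = inv T ` (?B \<inter> A)"
      using bij nrm by (auto simp: bij_vimage_eq_inv_image[symmetric] dist_norm)
    have Bs: "?B \<inter> A \<in> sets borel" "?B \<inter> T -` A \<in> sets borel"
      using A measurable_sets_borel[OF meas A] by auto
    have fin: "emeasure lborel (?B \<inter> C) \<noteq> \<infinity>" if "C \<in> sets borel" for C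
    proof -
      have "emeasure lborel (?B \<inter> C) \<le> emeasure lborel ?B"
        by (rule emeasure_mono) auto
      then show ?thesis
        using emeasure_cball_vec(2) by (auto simp: top_unique)
    qed
    have lm: "?B \<inter> A \<in> lmeasurable"
      using fin[OF A] Bs by (intro fmeasurableI) (auto simp: less_top)
    have "measure lebesgue (inv T ` (?B \<inter> A)) = measure lebesgue (?B \<inter> A)"
      using invT lm by (rule measure_orthogonal_image)
    then have "measure lborel (?B \<inter> T -` A) = measure lborel (?B \<inter> A)"
      using Bs by (simp flip: eq)
    then show ?thesis
      using fin[OF A] fin[OF measurable_sets_borel[OF meas A]]
      by (simp add: emeasure_eq_ennreal_measure)
  qed
  have U: "distr ?U borel T = ?U"
  proof (rule measure_eqI)
    fix A assume "A \<in> sets (distr ?U borel T)"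
    then have A: "A \<in> sets borel" by simp
    show "emeasure (distr ?U borel T) A = emeasure ?U A"
      using A measurable_sets_borel[OF meas A] vim[OF A]
      by (simp add: emeasure_distr)
  qed simp
  have "distr sphere_unif borel T = distr ?U borel (\<lambda>x. T (?r *\<^sub>R sgn x))"
    unfolding sphere_unif_def by (subst distr_distr) (auto simp: o_def)
  also have "(\<lambda>x. T (?r *\<^sub>R sgn x)) = (\<lambda>x. ?r *\<^sub>R sgn (T x))"
    using lin nrm by (auto simp: sgn_div_norm linear_cmul)
  also have "distr ?U borel (\<lambda>x. ?r *\<^sub>R sgn (T x)) = distr (distr ?U borel T) borel (\<lambda>x. ?r *\<^sub>R sgn x)"
    by (subst distr_distr) (auto simp: o_def)
  also have "\<dots> = sphere_unif"
    unfolding U sphere_unif_def ..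
  finally show ?thesis .
qed

lemma K_prob_distribution:
  assumes "N \<ge> 1" "0 < \<delta>" "\<delta> < 1"
  shows "\<And>k. K_prob N \<delta> k \<ge> 0" "(\<Sum>k=1..N. K_prob N \<delta> k) = 1"
proof -
  have "chi_square_density k t \<ge> 0" for k t
    by (cases "k = 0") (simp_all add: chi_square_density_def Gamma_real_pos less_imp_le)
  then have nonneg: "K_weight N \<delta> k \<ge> 0" for k
    using assms by (simp add: K_weight_def)
  have "K_weight N \<delta> N > 0"
    using assms by (simp add: K_weight_def chi_square_density_def Gamma_real_pos)
  moreover have "K_weight N \<delta> N \<le> (\<Sum>m=1..N. K_weight N \<delta> m)"
    using assms nonneg by (intro member_le_sum) auto
  ultimately have pos: "(\<Sum>m=1..N. K_weight N \<delta> m) > 0"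
    by linarith
  show "K_prob N \<delta> k \<ge> 0" for k
    using nonneg pos by (simp add: K_prob_def)
  show "(\<Sum>k=1..N. K_prob N \<delta> k) = 1"
    using pos by (simp add: K_prob_def flip: sum_divide_distrib)
qed

lemma mix_prod_pos:
  assumes "a > 0" "0 < \<delta>" "\<delta> < 1"
  shows "mix_prod a \<delta> v > 0"
  using assms by (auto simp: mix_prod_def gauss_mix_def gauss_def normal_density_pos
      intro!: prod_pos add_pos_pos mult_pos_pos)

lemma mix_density_prob:
  assumes "a > 0" "0 < \<delta>" "\<delta> < 1"
  shows "(LINT v|(sphere_unif :: (real^'n) measure). mix_density a \<delta> v) = 1"
    and "mix_density a \<delta> (v :: real^'n) > 0"
proof -
  interpret prob_space "sphere_unif :: (real^'n) measure"
    by (rule prob_space_sphere_unif)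
  have bnd: "gauss_mix a \<delta> x \<le> (1 - \<delta>) / sqrt (2 * pi * a) + \<delta> / sqrt (2 * pi)" for x
    using assms unfolding gauss_mix_def
    by (intro add_mono) (auto simp: gauss_eq intro!: divide_right_mono mult_left_le)
  have [measurable]: "(mix_prod a \<delta> :: real^'n \<Rightarrow> real) \<in> borel_measurable borel"
    unfolding mix_prod_def gauss_mix_def gauss_def normal_density_def by measurable
  have mb: "mix_prod a \<delta> (w :: real^'n) \<le> ((1 - \<delta>) / sqrt (2 * pi * a) + \<delta> / sqrt (2 * pi)) ^ CARD('n)" for w
  proof -
    have "mix_prod a \<delta> w \<le> (\<Prod>i\<in>(UNIV :: 'n set). (1 - \<delta>) / sqrt (2 * pi * a) + \<delta> / sqrt (2 * pi))"
      unfolding mix_prod_def using assms bnd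
      by (intro prod_mono) (auto simp: gauss_mix_def gauss_def intro!: add_nonneg_nonneg mult_nonneg_nonneg)
    then show ?thesis by simp
  qed
  have pos: "mix_prod a \<delta> (w :: real^'n) > 0" for w
    using assms by (rule mix_prod_pos)
  have int: "integrable sphere_unif (mix_prod a \<delta> :: real^'n \<Rightarrow> real)"
  proof (rule integrable_const_bound)
    show "AE w :: real^'n in sphere_unif. norm (mix_prod a \<delta> w)
            \<le> ((1 - \<delta>) / sqrt (2 * pi * a) + \<delta> / sqrt (2 * pi)) ^ CARD('n)"
      using mb pos by (intro AE_I2) (metis abs_of_pos real_norm_def)
  qed measurable
  have "(LINT w|(sphere_unif :: (real^'n) measure). mix_prod a \<delta> w) \<noteq> 0"
  proof
    assume "(LINT w|(sphere_unif :: (real^'n) measure). mix_prod a \<delta> w) = 0"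
    then have "AE w :: real^'n in sphere_unif. mix_prod a \<delta> w = 0"
      using integral_nonneg_eq_0_iff_AE[OF int] pos by (simp add: less_imp_le)
    then have "AE w :: real^'n in sphere_unif. False"
      using pos by (simp add: order_less_imp_not_eq2)
    then show False by simp
  qed
  moreover have "(LINT w|(sphere_unif :: (real^'n) measure). mix_prod a \<delta> w) \<ge> 0"
    using pos by (intro Bochner_Integration.integral_nonneg) (simp add: less_imp_le)
  ultimately have Z: "(LINT w|(sphere_unif :: (real^'n) measure). mix_prod a \<delta> w) > 0"
    by linarith
  show "(LINT v|(sphere_unif :: (real^'n) measure). mix_density a \<delta> v) = 1"
    unfolding mix_density_def using Z by simp
  show "mix_density a \<delta> v > 0"
    unfolding mix_density_def using Z pos by simp
qed

end

theory Submission
  imports Defs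
begin

text \<open>
  Expand \<open>\<Prod>\<^sub>i f\<^sub>a\<^sub>,\<^sub>\<delta>(v\<^sub>i)\<close> into the \<open>2\<^sup>N\<close> products of Gaussians indexed by the set \<open>S\<close> of
  coordinates that carry the variance 1, the others carrying the variance \<open>a\<close>. Since the uniform measure is the law of
  \<open>sqrt N X/|X|\<close> with \<open>X\<close> uniform in the unit ball, rescaling the coordinates outside \<open>S\<close> by \<open>sqrt a\<close>
  turns the integral of such a product against \<open>\<phi>\<close> into an integral over a fixed space, dominated by a
  Gaussian. As \<open>a\<close> tends to 0 its mass tends to a multiple, depending on \<open>N\<close> only, of \<open>q\<^sub>k(N)\<close> with \<open>k = |S|\<close>;
  hence \<open>|S|\<close> is distributed like \<open>K\<^sub>\<delta>\<close> in the limit.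

  Moreover \<open>log f\<^sub>a\<^sub>,\<^sub>\<delta>(v\<^sub>i)/\<ell>\<^sub>a\<close> is bounded, tends to 1/2 where \<open>v\<^sub>i = O(sqrt a)\<close> and to 0 where \<open>v\<^sub>i\<close> has
  a nonzero limit. The entropy thus counts the coordinates outside \<open>S\<close>. In the dissipation, a generic rotation
  of the pair \<open>(i, j)\<close> keeps both coordinates small only if neither belongs to \<open>S\<close>, and makes both of
  them large otherwise, so the pairs separated by \<open>S\<close> are counted.
\<close>

section \<open>Rescaling a set of coordinates\<close>

text \<open>Starting from the ball is what gives domination. At the projected point the Gaussian
  exponents add up to N/2 times |x|^2 / |shrink x|^2, the Jacobian of the rescaling cancels the
  factors a^(-1/2) of the narrow Gaussians, and |shrink x| <= 1 in the ball, so exp(- N/2 |x|^2)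
  bounds the kernel for every a. The empty set is exceptional: its exponent is -N/(2a), since a
  sphere of fixed radius has no room for N narrow coordinates. This is why K starts at 1.

  In the dissipation the obstacle is F at the rotated point, because a rotation mixes coordinates of
  widths 1 and sqrt a. Invariance of the measure trades this term for F at v with the opposite
  angle, so that only increments of log F have to be followed, and these are bounded after division
  by the logarithmic scale. Their limit for one pair depends on S itself; summed over all pairs it
  depends on |S| alone. The normalising constant tends to a positive number: its logarithm is
  negligible in the entropy and cancels in the dissipation.\<close>

definition sqsum :: "'n set \<Rightarrow> real^'n \<Rightarrow> real" where
  "sqsum S x = (\<Sum>i\<in>S. (x $ i)\<^sup>2)"

text \<open>At a = 0 this is the coordinate projection onto S, because \<open>sqrt 0 = 0\<close>;
  limiting objects are thus the same formulas taken at 0.\<close>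

definition shrink :: "'n set \<Rightarrow> real \<Rightarrow> real^'n \<Rightarrow> real^'n" where
  "shrink S a x = (\<chi> i. if i \<in> S then x $ i else sqrt a * x $ i)"

definition shrink_proj :: "'n set \<Rightarrow> real \<Rightarrow> real^'n \<Rightarrow> real^'n" where
  "shrink_proj S a x = sqrt (real CARD('n)) *\<^sub>R sgn (shrink S a x)"

lemma sqsum_nonneg [simp]: "sqsum S x \<ge> 0"
  by (simp add: sqsum_def sum_nonneg)

lemma sqsum_UNIV: "sqsum UNIV x = (norm x)\<^sup>2"
  by (simp add: sqsum_def norm_vec_def L2_set_def sum_nonneg)

lemma sqsum_split: "sqsum S x + sqsum (-S) x = (norm (x :: real^'n))\<^sup>2"
proof -
  have "sqsum (S \<union> -S) x = sqsum S x + sqsum (-S) x"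
    unfolding sqsum_def by (rule sum.union_disjoint) auto
  then show ?thesis by (simp add: sqsum_UNIV)
qed

lemma norm_shrink:
  assumes "a \<ge> 0"
  shows "(norm (shrink S a x))\<^sup>2 = sqsum S x + a * sqsum (-S) (x :: real^'n)"
proof -
  have "(norm (shrink S a x))\<^sup>2 = sqsum S (shrink S a x) + sqsum (-S) (shrink S a x)"
    by (simp add: sqsum_split)
  also have "sqsum S (shrink S a x) = sqsum S x"
    by (simp add: sqsum_def shrink_def)
  also have "sqsum (-S) (shrink S a x) = a * sqsum (-S) x"
    using assms by (simp add: sqsum_def shrink_def power_mult_distrib sum_distrib_left)
  finally show ?thesis .
qed

lemma measurable_vec_nth_borel [measurable]: "(\<lambda>x :: real^'n. x $ i) \<in> borel_measurable borel"
  by (intro borel_measurable_continuous_onI continuous_intros)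

lemma measurable_sqsum [measurable]: "(sqsum S :: real^'n \<Rightarrow> real) \<in> borel_measurable borel"
  unfolding sqsum_def by measurable

lemma measurable_shrink [measurable]: "(shrink S a :: real^'n \<Rightarrow> _) \<in> borel_measurable borel"
  unfolding shrink_def
proof (intro borel_measurable_continuous_onI continuous_on_vec_lambda)
  fix i :: 'n
  show "continuous_on UNIV (\<lambda>x :: real^'n. if i \<in> S then x $ i else sqrt a * x $ i)"
    by (cases "i \<in> S") (auto intro!: continuous_intros)
qed

lemma measurable_shrink_proj [measurable]: "(shrink_proj S a :: real^'n \<Rightarrow> _) \<in> borel_measurable borel"
  unfolding shrink_proj_def by measurable

lemma Basis_vec_real: "(Basis :: (real^'n) set) = range (\<lambda>i. axis i 1)"
  by (auto simp: Basis_vec_def)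

lemma prod_Basis_vec: "(\<Prod>b\<in>(Basis :: (real^'n) set). f b) = (\<Prod>i\<in>UNIV. f (axis i 1))"
  unfolding Basis_vec_real by (subst prod.reindex) (auto simp: inj_on_def axis_eq_axis)

lemma sum_Basis_vec: "(\<Sum>b\<in>(Basis :: (real^'n) set). f b) = (\<Sum>i\<in>UNIV. f (axis i 1))"
  unfolding Basis_vec_real by (subst sum.reindex) (auto simp: inj_on_def axis_eq_axis)

text \<open>Both measures agree on boxes. Indexing the product by \<open>'n\<close> instead of
  \<open>Basis\<close> allows Fubini to separate the coordinates in S from the others.\<close>

lemma lborel_vec: "lborel = distr (Pi\<^sub>M UNIV (\<lambda>_::'n::finite. lborel)) borel (\<lambda>f. (\<chi> i. f i) :: real^'n)"
proof (rule lborel_eqI)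
  have m [measurable]: "(\<lambda>f. (\<chi> i. f i) :: real^'n) \<in> measurable (Pi\<^sub>M UNIV (\<lambda>_::'n. lborel)) borel"
    by (rule borel_measurable_euclidean_space[THEN iffD2]) 
       (auto simp: Basis_vec_real inner_axis intro!: measurable_component_singleton)
  interpret product_sigma_finite "\<lambda>_::'n. lborel :: real measure" by standard
  fix l u :: "real^'n" assume le: "\<And>b. b \<in> Basis \<Longrightarrow> l \<bullet> b \<le> u \<bullet> b"
  then have le': "l $ i \<le> u $ i" for i
    using le[of "axis i 1"] by (simp add: inner_axis)
  have "emeasure (distr (Pi\<^sub>M UNIV (\<lambda>_::'n. lborel)) borel (\<lambda>f. (\<chi> i. f i) :: real^'n)) (box l u)
      = emeasure (Pi\<^sub>M UNIV (\<lambda>_::'n. lborel)) (Pi\<^sub>E UNIV (\<lambda>i. {l $ i<..<u $ i}))"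
    by (subst emeasure_distr) (auto intro!: arg_cong2[where f=emeasure] simp: space_PiM mem_box_cart PiE_def Pi_def)
  also have "\<dots> = (\<Prod>i\<in>UNIV. ennreal (u $ i - l $ i))"
    using le' by (subst emeasure_PiM) auto
  finally show "emeasure (distr (Pi\<^sub>M UNIV (\<lambda>_::'n. lborel)) borel (\<lambda>f. (\<chi> i. f i) :: real^'n)) (box l u) = 
    ennreal (\<Prod>b\<in>Basis. (u - l) \<bullet> b)"
    using le' by (simp add: prod_Basis_vec inner_axis prod_ennreal)
qed simp

text \<open>\<open>shrink S a\<close> is diagonal, with determinant sqrt a to the number of
  coordinates outside S.\<close>

lemma lborel_shrink:
  assumes "a > 0"
  shows "lborel = density (distr lborel borel (shrink S a)) (\<lambda>_. ennreal (sqrt a ^ card (- S :: 'n::finite set)))"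
proof -
  \<comment> \<open>The change of variables wants scaling factors indexed by basis vectors. This
    product reads the index off the nonzero coordinate of \<open>axis i 1\<close> and never
    vanishes, whatever the argument.\<close>
  define c :: "real^'n \<Rightarrow> real" where "c b = (\<Prod>i\<in>UNIV. if b $ i \<noteq> 0 \<and> i \<notin> S then sqrt a else 1)" for b
  have c: "c (axis i 1) = (if i \<in> S then 1 else sqrt a)" for i
  proof -
    have "c (axis i 1) = (\<Prod>j\<in>UNIV. if j = i then (if i \<in> S then 1 else sqrt a) else 1)"
      unfolding c_def by (intro prod.cong) (auto simp: axis_def)
    then show ?thesis by simp
  qed
  have "shrink S a = (\<lambda>x. 0 + (\<Sum>j\<in>Basis. (c j * (x \<bullet> j)) *\<^sub>R j))"
  proof (intro ext vec_eq_iff[THEN iffD2] allI)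
    fix x :: "real^'n" and k
    have ax: "(axis i 1 :: real^'n) $ k = (if i = k then 1 else 0)" for i
      by (simp add: axis_def)
    have "(\<Sum>j\<in>Basis. (c j * (x \<bullet> j)) *\<^sub>R j) $ k = (\<Sum>i\<in>UNIV. if i = k then c (axis k 1) * x $ k else 0)"
      by (subst sum_Basis_vec, subst sum_component, intro sum.cong) (auto simp: inner_axis ax)
    then show "shrink S a x $ k = (0 + (\<Sum>j\<in>Basis. (c j * (x \<bullet> j)) *\<^sub>R j)) $ k"
      by (simp add: c shrink_def)
  qed
  moreover have "(\<Prod>j\<in>Basis. \<bar>c j\<bar>) = sqrt a ^ card (-S)"
  proof -
    have "(\<Prod>j\<in>Basis. \<bar>c j\<bar>) = (\<Prod>i\<in>UNIV. if i \<in> -S then sqrt a else 1)"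
      using assms by (subst prod_Basis_vec, intro prod.cong) (auto simp: c)
    also have "\<dots> = (\<Prod>i\<in>-S. sqrt a)"
      using prod.inter_restrict[of UNIV "\<lambda>_. sqrt a" "-S"] by simp
    finally show ?thesis by simp
  qed
  moreover have "c j \<noteq> 0" for j
    using assms by (auto simp: c_def)
  ultimately show ?thesis
    using lborel_affine_euclidean[of c 0] by simp
qed

lemma AE_vec_nth_nonzero: "AE x :: real^'n in lborel. x $ i \<noteq> 0"
proof -
  have "negligible {x :: real^'n. x \<bullet> axis i 1 = 0}"
    by (rule negligible_standard_hyperplane) simp
  moreover have "{x :: real^'n. x \<bullet> axis i 1 = 0} = {x. x $ i = 0}"
    by (simp add: inner_axis)
  ultimately have "{x :: real^'n. x $ i = 0} \<in> null_sets lborel"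
    by (simp add: negligible_iff_null_sets null_sets_completion_iff)
  from AE_not_in[OF this] show ?thesis by simp
qed

text \<open>The exceptional set is a hyperplane. Rotated coordinates are such combinations, and
  their limits must not vanish.\<close>

lemma AE_lincomb_nonzero:
  assumes "i \<noteq> j" "c \<noteq> 0 \<or> d \<noteq> 0"
  shows "AE x :: real^'n in lborel. c * x $ i + d * x $ j \<noteq> 0"
proof -
  have "c *\<^sub>R axis i 1 + d *\<^sub>R axis j 1 \<noteq> (0 :: real^'n)"
  proof
    assume *: "c *\<^sub>R axis i 1 + d *\<^sub>R axis j 1 = (0 :: real^'n)"
    from arg_cong[OF *, of "\<lambda>x. x $ i"] arg_cong[OF *, of "\<lambda>x. x $ j"] assms show False
      by (auto simp: axis_def)
  qed
  then have "negligible {x :: real^'n. (c *\<^sub>R axis i 1 + d *\<^sub>R axis j 1) \<bullet> x = 0}"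
    by (intro negligible_hyperplane) simp
  moreover have "{x :: real^'n. (c *\<^sub>R axis i 1 + d *\<^sub>R axis j 1) \<bullet> x = 0} = {x. c * x $ i + d * x $ j = 0}"
    by (simp add: inner_axis inner_axis' inner_add_left)
  ultimately have "{x :: real^'n. c * x $ i + d * x $ j = 0} \<in> null_sets lborel"
    by (simp add: negligible_iff_null_sets null_sets_completion_iff)
  from AE_not_in[OF this] show ?thesis by simp
qed

text \<open>The cylinder lies in the frontier of a convex set, which is negligible. It has to be
  avoided because the indicator of the ball jumps there in the limit.\<close>

lemma AE_sqsum_ne_1: "AE x :: real^'n in lborel. sqsum S x \<noteq> 1"
proof -
  define C where "C = {x :: real^'n. L2_set (($) x) S \<le> 1}"
  have sq: "L2_set (($) x) S = sqrt (sqsum S x)" for x :: "real^'n"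
    by (simp add: L2_set_def sqsum_def)
  have "convex C"
  proof (rule convexI)
    fix x y :: "real^'n" and u v :: real
    assume xy: "x \<in> C" "y \<in> C" and uv: "u \<ge> 0" "v \<ge> 0" "u + v = 1"
    have "L2_set (($) (u *\<^sub>R x + v *\<^sub>R y)) S \<le> L2_set (\<lambda>i. u * x $ i) S + L2_set (\<lambda>i. v * y $ i) S"
      using L2_set_triangle_ineq[of "\<lambda>i. u * x $ i" "\<lambda>i. v * y $ i" S] by (simp add: L2_set_def)
    also have "\<dots> = u * L2_set (($) x) S + v * L2_set (($) y) S"
      using uv by (simp add: L2_set_right_distrib)
    also have "\<dots> \<le> u * 1 + v * 1"
      using xy uv by (intro add_mono mult_left_mono) (auto simp: C_def)
    finally show "u *\<^sub>R x + v *\<^sub>R y \<in> C"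
      using uv by (simp add: C_def)
  qed
  then have "negligible (frontier C)"
    by (rule negligible_convex_frontier)
  moreover have "{x. sqsum S x = 1} \<subseteq> frontier C"
  proof
    fix x assume "x \<in> {x. sqsum S x = 1}"
    then have x: "sqsum S x = 1" by simp
    have "x \<notin> interior C"
    proof
      assume "x \<in> interior C"
      then obtain e where e: "e > 0" "ball x e \<subseteq> C"
        using mem_interior by blast
      \<comment> \<open>The dilation by 1 + t moves x by less than e, hence stays in C, yet
        multiplies \<open>sqsum S x = 1\<close> by (1 + t)^2 > 1. The \<open>+ 1\<close> keeps the
        denominator positive without a look at \<open>norm x\<close>.\<close>
      define t where "t = e / (2 * (norm x + 1))"
      have t: "t > 0" using e by (auto simp: t_def intro!: divide_pos_pos add_nonneg_pos)
      have "dist x ((1 + t) *\<^sub>R x) = t * norm x"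
        using t by (simp add: dist_norm algebra_simps)
      also have "\<dots> = e * (norm x / (2 * (norm x + 1)))"
        by (simp add: t_def)
      also have "\<dots> < e * 1"
        using e by (intro mult_strict_left_mono) (auto simp: divide_simps add_nonneg_eq_0_iff, smt norm_ge_zero)
      finally have "(1 + t) *\<^sub>R x \<in> C"
        using e by auto
      then have "sqsum S ((1 + t) *\<^sub>R x) \<le> 1"
        by (simp add: C_def sq)
      moreover have "sqsum S ((1 + t) *\<^sub>R x) = (1 + t)\<^sup>2 * sqsum S x"
        by (simp add: sqsum_def power_mult_distrib sum_distrib_left)
      ultimately have "(1 + t)\<^sup>2 \<le> 1" using x by simp
      with t show False by (simp add: power2_eq_square algebra_simps) (smt mult_pos_pos)
    qed
    moreover have "x \<in> closure C"
      using x closure_subset by (force simp: C_def sq)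
    ultimately show "x \<in> frontier C" by (simp add: frontier_def)
  qed
  ultimately have "negligible {x :: real^'n. sqsum S x = 1}"
    by (rule negligible_subset)
  then have "{x :: real^'n. sqsum S x = 1} \<in> null_sets lborel"
    by (simp add: negligible_iff_null_sets null_sets_completion_iff)
  from AE_not_in[OF this] show ?thesis by simp
qed

lemma AE_sqsum_pos:
  assumes "S \<noteq> {}"
  shows "AE x :: real^'n in lborel. sqsum S x > 0"
proof -
  obtain i where i: "i \<in> S" using assms by blast
  show ?thesis
    using AE_vec_nth_nonzero[of i]
  proof eventually_elim
    case (elim x)
    have "(x $ i)\<^sup>2 \<le> sqsum S x"
      unfolding sqsum_def using i by (intro member_le_sum) auto
    with elim show ?case
      using zero_less_power2[of "x $ i"] by linarith
  qed
qed

section \<open>Gaussian products on the sphere\<close>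

lemma eventually_at_right_0_less: "\<epsilon> > 0 \<Longrightarrow> \<forall>\<^sub>F a :: real in at_right 0. 0 < a \<and> a < \<epsilon>"
  by (auto simp: eventually_at_right_field intro!: exI[of _ \<epsilon>])

lemma norm_shrink_tendsto:
  "((\<lambda>a. norm (shrink S a (x :: real^'n))) \<longlongrightarrow> sqrt (sqsum S x)) (at_right 0)"
proof -
  have "((\<lambda>a. sqrt (sqsum S x + a * sqsum (-S) x)) \<longlongrightarrow> sqrt (sqsum S x + 0 * sqsum (-S) x)) (at_right 0)"
    by (intro tendsto_intros)
  moreover have "\<forall>\<^sub>F a in at_right 0. sqrt (sqsum S x + a * sqsum (-S) x) = norm (shrink S a x)"
    using eventually_at_right_0_less[OF zero_less_one]
    by eventually_elim (simp add: norm_shrink[symmetric])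
  ultimately show ?thesis
    by (auto intro: Lim_transform_eventually)
qed

lemma shrink_proj_in_kac_sphere:
  assumes "a > 0" "x \<noteq> 0"
  shows "shrink_proj S a (x :: real^'n) \<in> kac_sphere"
proof -
  have "shrink S a x \<noteq> 0"
    using assms by (auto simp: shrink_def vec_eq_iff split: if_splits)
  then show ?thesis by (simp add: norm_kac_sphere shrink_proj_def norm_sgn)
qed

lemma sets_borel_cball [measurable]: "cball (c :: 'a::metric_space) r \<in> sets borel"
  by simp


text \<open>The left side knows neither S nor a: the same integral is rewritten with a different
  rescaling for each Gaussian product.\<close>

lemma sphere_integral:
  fixes H :: "real^'n \<Rightarrow> real"
  assumes [measurable]: "H \<in> borel_measurable borel" and a: "a > 0"
  shows "(LINT v|sphere_unif. H v) = sqrt a ^ card (-S) / measure lborel (cball (0 :: real^'n) 1) *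
     (LINT x|lborel. indicator (cball 0 1) (shrink S a x) * H (shrink_proj S a x))"
proof -
  define \<beta> where "\<beta> = measure lborel (cball (0 :: real^'n) 1)"
  have \<beta>: "emeasure lborel (cball (0 :: real^'n) 1) = ennreal \<beta>" "\<beta> > 0"
    using emeasure_lborel_cball_finite[of "0 :: real^'n" 1] content_cball_pos[of 1 "0 :: real^'n"]
    by (auto simp: \<beta>_def emeasure_eq_ennreal_measure)
  have U: "uniform_measure lborel (cball (0 :: real^'n) 1) =
      density lborel (\<lambda>x. ennreal (indicator (cball 0 1) x / \<beta>))"
    unfolding uniform_measure_def \<beta>(1)
    by (intro arg_cong[where f="density lborel"] ext)
       (use \<beta>(2) in \<open>auto simp: divide_ennreal[symmetric] simp flip: ennreal_indicator\<close>)
  have "(LINT v|sphere_unif. H v) = 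
      (LINT x|lborel. indicator (cball 0 1) x / \<beta> * H (sqrt (real CARD('n)) *\<^sub>R sgn x))"
    unfolding sphere_unif_def U
    using \<beta>(2) by (subst integral_distr, measurable, subst integral_density) (auto intro!: divide_nonneg_pos)
  \<comment> \<open>Lebesgue measure is replaced by its own rescaled image, so that the ball and the
    direction are evaluated at \<open>shrink S a x\<close>.\<close>
  also have "\<dots> = (LINT x|density (distr lborel borel (shrink S a)) (\<lambda>_. ennreal (sqrt a ^ card (- S))).
      indicator (cball 0 1) x / \<beta> * H (sqrt (real CARD('n)) *\<^sub>R sgn x))"
    using lborel_shrink[OF a, of S] by simp
  also have "\<dots> = (LINT x|lborel. sqrt a ^ card (- S) * (indicator (cball 0 1) (shrink S a x) / \<beta> * H (shrink_proj S a x)))"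
    unfolding shrink_proj_def using a
    by (subst integral_density) (auto simp: integral_distr)
  also have "\<dots> = (LINT x|lborel. (sqrt a ^ card (- S) / \<beta>) * (indicator (cball 0 1) (shrink S a x) * H (shrink_proj S a x)))"
    by (simp add: mult_ac)
  also have "\<dots> = sqrt a ^ card (- S) / \<beta> * (LINT x|lborel. indicator (cball 0 1) (shrink S a x) * H (shrink_proj S a x))"
    by (rule integral_mult_right_zero)
  finally show ?thesis by (simp add: \<beta>_def)
qed

definition gauss_split :: "'n set \<Rightarrow> real \<Rightarrow> real^'n \<Rightarrow> real" where
  "gauss_split S a v = (\<Prod>i\<in>S. gauss 1 (v $ i)) * (\<Prod>i\<in>-S. gauss a (v $ i))"

text \<open>Up to the factor (2 pi)^(-N/2), this is what remains of \<open>gauss_split S a\<close>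
  at the projected point once the Jacobian is included; N/2 comes from the squared radius N of the
  sphere.\<close>

definition split_kernel :: "'n set \<Rightarrow> real \<Rightarrow> real^'n \<Rightarrow> real" where
  "split_kernel S a x = indicator (cball 0 1) (shrink S a x) *
     exp (- (real CARD('n) / 2 * ((norm x)\<^sup>2 / (norm (shrink S a x))\<^sup>2)))"

text \<open>Outside S the factor sqrt a in the coordinate cancels the variance a in the exponent, so
  every coordinate contributes as if its variance were 1, and the exponents sum to the full norm of
  x.\<close>

lemma gauss_split_shrink_proj:
  fixes x :: "real^'n"
  assumes a: "a > 0"
  shows "sqrt a ^ card (-S) * gauss_split S a (shrink_proj S a x) =
    (1 / sqrt (2 * pi)) ^ CARD('n) * exp (- (real CARD('n) / 2 * ((norm x)\<^sup>2 / (norm (shrink S a x))\<^sup>2)))"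
proof -
  define r where "r = sqrt (real CARD('n)) / norm (shrink S a x)"
  define e where "e i = exp (- (r\<^sup>2 / 2 * (x $ i)\<^sup>2))" for i
  have v: "shrink_proj S a x $ i = r * (if i \<in> S then x $ i else sqrt a * x $ i)" for i
    by (simp add: shrink_proj_def sgn_div_norm r_def divide_inverse) (simp add: shrink_def)
  have "gauss_split S a (shrink_proj S a x) =
     (\<Prod>i\<in>S. 1 / sqrt (2 * pi) * e i) * (\<Prod>i\<in>-S. 1 / sqrt a * (1 / sqrt (2 * pi) * e i))"
    unfolding gauss_split_def v e_def using a
    by (intro arg_cong2[where f="(*)"] prod.cong)
       (auto simp: gauss_eq power_mult_distrib real_sqrt_mult)
  also have "\<dots> = 1 / sqrt a ^ card (-S) * 
      ((\<Prod>i\<in>S. 1 / sqrt (2 * pi) * e i) * (\<Prod>i\<in>-S. 1 / sqrt (2 * pi) * e i))"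
    unfolding prod.distrib[of _ _ "-S"] by (simp add: power_divide)
  also have "(\<Prod>i\<in>S. 1 / sqrt (2 * pi) * e i) * (\<Prod>i\<in>-S. 1 / sqrt (2 * pi) * e i) = 
      (\<Prod>i\<in>S \<union> -S. 1 / sqrt (2 * pi) * e i)"
    by (rule prod.union_disjoint[symmetric]) auto
  also have "\<dots> = (1 / sqrt (2 * pi)) ^ CARD('n) * (\<Prod>i\<in>UNIV. e i)"
    by (subst prod.distrib) simp
  also have "(\<Prod>i\<in>UNIV. e i) = exp (- (r\<^sup>2 / 2 * sqsum UNIV x))"
    unfolding e_def by (subst exp_sum[symmetric]) (auto simp: sqsum_def sum_distrib_left sum_negf)
  also have "r\<^sup>2 / 2 * sqsum UNIV x = real CARD('n) / 2 * ((norm x)\<^sup>2 / (norm (shrink S a x))\<^sup>2)"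
    by (simp add: sqsum_UNIV r_def power_divide)
  finally show ?thesis using a by simp
qed

lemma measurable_split_kernel [measurable]: "(split_kernel S a :: real^'n \<Rightarrow> real) \<in> borel_measurable borel"
  unfolding split_kernel_def by measurable

lemma measurable_gauss_split [measurable]: "(gauss_split S a :: real^'n \<Rightarrow> real) \<in> borel_measurable borel"
  unfolding gauss_split_def gauss_def normal_density_def by measurable

lemma sphere_integral_gauss_split:
  fixes \<phi> :: "real^'n \<Rightarrow> real"
  assumes [measurable]: "\<phi> \<in> borel_measurable borel" and a: "a > 0"
  shows "(LINT v|sphere_unif. gauss_split S a v * \<phi> v) =
    (1 / sqrt (2 * pi)) ^ CARD('n) / measure lborel (cball (0 :: real^'n) 1) *
    (LINT x|lborel. split_kernel S a x * \<phi> (shrink_proj S a x))"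
proof -
  have "(LINT v|sphere_unif. gauss_split S a v * \<phi> v) = 1 / measure lborel (cball (0 :: real^'n) 1) *
    (sqrt a ^ card (-S) * (LINT x|lborel. indicator (cball 0 1) (shrink S a x) *
       (gauss_split S a (shrink_proj S a x) * \<phi> (shrink_proj S a x))))"
    by (subst sphere_integral[OF _ a, of _ S]) auto
  also have "sqrt a ^ card (-S) * (LINT x|lborel. indicator (cball 0 1) (shrink S a x) *
       (gauss_split S a (shrink_proj S a x) * \<phi> (shrink_proj S a x))) =
     (LINT x|lborel. sqrt a ^ card (-S) * (indicator (cball 0 1) (shrink S a x) *
       (gauss_split S a (shrink_proj S a x) * \<phi> (shrink_proj S a x))))"
    by (rule integral_mult_right_zero[symmetric])
  also have "\<dots> = (LINT x|lborel. (sqrt a ^ card (-S) * gauss_split S a (shrink_proj S a x)) * 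
       (indicator (cball 0 1) (shrink S a x) * \<phi> (shrink_proj S a x)))"
    by (simp add: mult_ac)
  also have "\<dots> = (LINT x|lborel. (1 / sqrt (2 * pi)) ^ CARD('n) * (split_kernel S a x * \<phi> (shrink_proj S a x)))"
    unfolding gauss_split_shrink_proj[OF a] split_kernel_def by (simp add: mult_ac)
  also have "\<dots> = (1 / sqrt (2 * pi)) ^ CARD('n) * (LINT x|lborel. split_kernel S a x * \<phi> (shrink_proj S a x))"
    by (rule integral_mult_right_zero)
  finally show ?thesis by simp
qed

section \<open>Domination and passage to the limit for one Gaussian product\<close>

lemma nn_integral_exp_square:
  assumes "c > 0"
  shows "(\<integral>\<^sup>+x. ennreal (exp (- (c * x\<^sup>2))) \<partial>lborel) = ennreal (sqrt (pi / c))"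
proof -
  define \<sigma> where "\<sigma> = sqrt (1 / (2 * c))"
  have \<sigma>: "\<sigma> > 0" "\<sigma>\<^sup>2 = 1 / (2 * c)" using assms by (auto simp: \<sigma>_def)
  interpret prob_space "density lborel (normal_density 0 \<sigma>)"
    by (rule prob_space_normal_density) fact
  have 1: "(\<integral>\<^sup>+x. ennreal (normal_density 0 \<sigma> x) \<partial>lborel) = 1"
    using emeasure_space_1 by (simp add: emeasure_density)
  have "exp (- (c * x\<^sup>2)) = sqrt (pi / c) * normal_density 0 \<sigma> x" for x
    using assms by (simp add: normal_density_def \<sigma>)
  then have "(\<integral>\<^sup>+x. ennreal (exp (- (c * x\<^sup>2))) \<partial>lborel) = 
     (\<integral>\<^sup>+x. ennreal (sqrt (pi / c)) * ennreal (normal_density 0 \<sigma> x) \<partial>lborel)"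
    using assms by (simp add: ennreal_mult)
  also have "\<dots> = ennreal (sqrt (pi / c)) * (\<integral>\<^sup>+x. ennreal (normal_density 0 \<sigma> x) \<partial>lborel)"
    by (rule nn_integral_cmult) simp
  finally show ?thesis using 1 by simp
qed

lemma integrable_exp_norm_square:
  assumes "c > 0"
  shows "integrable lborel (\<lambda>x :: real^'n. exp (- (c * (norm x)\<^sup>2)))"
proof (rule integrableI_bounded)
  have "(\<integral>\<^sup>+x. ennreal (norm (exp (- (c * (norm (x :: real^'n))\<^sup>2)))) \<partial>lborel) = 
     (\<integral>\<^sup>+x. (\<Prod>b\<in>(Basis :: (real^'n) set). ennreal (exp (- (c * (x \<bullet> b)\<^sup>2)))) \<partial>lborel)"
    by (intro nn_integral_cong)
       (simp add: prod_ennreal exp_sum[symmetric] prod_Basis_vec inner_axis sqsum_def sum_distrib_left sum_negf 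
         flip: sqsum_UNIV)
  also have "\<dots> = (\<Prod>b\<in>(Basis::(real^'n) set). (\<integral>\<^sup>+x. ennreal (exp (- (c * x\<^sup>2))) \<partial>lborel))"
    by (rule nn_integral_lborel_prod) auto
  also have "\<dots> < \<infinity>"
    by (simp add: nn_integral_exp_square[OF assms] power_less_top_ennreal)
  finally show "(\<integral>\<^sup>+x. ennreal (norm (exp (- (c * (norm (x :: real^'n))\<^sup>2)))) \<partial>lborel) < \<infinity>" .
qed measurable

text \<open>The indicator forces \<open>norm (shrink S a x) \<le> 1\<close>, and dividing by it only
  enlarges the exponent. The bound is free of a and S, as dominated convergence requires.\<close>

lemma split_kernel_le:
  fixes x :: "real^'n"
  assumes "a > 0" "x \<noteq> 0"
  shows "split_kernel S a x \<le> exp (- (real CARD('n) / 2 * (norm x)\<^sup>2))"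
proof (cases "norm (shrink S a x) \<le> 1")
  case True
  have "shrink S a x \<noteq> 0"
    using assms by (auto simp: shrink_def vec_eq_iff split: if_splits)
  then have "(norm x)\<^sup>2 \<le> (norm x)\<^sup>2 / (norm (shrink S a x))\<^sup>2"
    using True by (simp add: le_divide_eq mult_left_le power_le_one)
  then have "real CARD('n) / 2 * (norm x)\<^sup>2 \<le> real CARD('n) / 2 * ((norm x)\<^sup>2 / (norm (shrink S a x))\<^sup>2)"
    by (intro mult_left_mono) auto
  then show ?thesis using True by (simp add: split_kernel_def)
qed (simp add: split_kernel_def)

lemma split_kernel_nonneg [simp]: "split_kernel S a x \<ge> 0"
  by (simp add: split_kernel_def)

text \<open>The first hypothesis keeps the denominator away from 0. The second makes the indicator
  eventually constant: the squared norm converges to a value other than the jump point 1.\<close>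

lemma split_kernel_tendsto:
  fixes x :: "real^'n"
  assumes x: "sqsum S x > 0" "sqsum S x \<noteq> 1"
  shows "((\<lambda>a. split_kernel S a x) \<longlongrightarrow> split_kernel S 0 x) (at_right 0)"
proof -
  have "((\<lambda>a. (norm (shrink S a x))\<^sup>2) \<longlongrightarrow> (sqrt (sqsum S x))\<^sup>2) (at_right 0)"
    by (intro tendsto_intros norm_shrink_tendsto)
  then have lim: "((\<lambda>a. (norm (shrink S a x))\<^sup>2) \<longlongrightarrow> sqsum S x) (at_right 0)"
    by simp
  have 0: "(norm (shrink S 0 x))\<^sup>2 = sqsum S x"
    by (simp add: norm_shrink)
  have ind: "indicator (cball 0 1) y = (indicator {..1} ((norm y)\<^sup>2) :: real)" for y :: "real^'n"
    by (auto simp: indicator_def power_le_one abs_square_le_1)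
  have "\<forall>\<^sub>F a in at_right 0. indicator {..1} ((norm (shrink S a x))\<^sup>2) = (indicator {..1} (sqsum S x) :: real)"
  proof (cases "sqsum S x < 1")
    case True
    from order_tendstoD(2)[OF lim True] show ?thesis
      by eventually_elim (use True in auto)
  next
    case False
    then have "sqsum S x > 1" using x by simp
    from order_tendstoD(1)[OF lim this] show ?thesis
      by eventually_elim (use \<open>sqsum S x > 1\<close> in auto)
  qed
  then have "((\<lambda>a. indicator {..1} ((norm (shrink S a x))\<^sup>2) :: real) \<longlongrightarrow> indicator {..1} (sqsum S x)) (at_right 0)"
    by (rule tendsto_eventually)
  then show ?thesis
    unfolding split_kernel_def ind 0 using x
    by (intro tendsto_mult tendsto_exp tendsto_minus tendsto_const tendsto_divide lim) auto
qed

text \<open>With S empty the quotient of squared norms is exactly 1/a, whatever x is, and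
  exp(-N/(2a)) tends to 0.\<close>

lemma split_kernel_empty_tendsto:
  fixes x :: "real^'n"
  assumes x: "x \<noteq> 0"
  shows "((\<lambda>a. split_kernel {} a x) \<longlongrightarrow> 0) (at_right 0)"
proof (rule tendsto_sandwich)
  show "\<forall>\<^sub>F a in at_right 0. 0 \<le> split_kernel {} a x" by simp
  have "\<forall>\<^sub>F a :: real in at_right 0. a > 0"
    by (simp add: eventually_at_right_less)
  then show "\<forall>\<^sub>F a in at_right 0. split_kernel {} a x \<le> exp (- (real CARD('n) / 2 * inverse a))"
  proof eventually_elim
    case (elim a)
    have "(norm (shrink {} a x))\<^sup>2 = a * (norm x)\<^sup>2"
      using elim by (simp add: norm_shrink sqsum_UNIV) (simp add: sqsum_def)
    then have "(norm x)\<^sup>2 / (norm (shrink {} a x))\<^sup>2 = inverse a"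
      using x by (simp add: field_simps)
    then show ?case by (simp add: split_kernel_def indicator_def)
  qed
  have "filterlim (\<lambda>a::real. real CARD('n) / 2 * inverse a) at_top (at_right 0)"
    by (intro filterlim_tendsto_pos_mult_at_top[OF tendsto_const] filterlim_inverse_at_top_right) simp
  then show "((\<lambda>a. exp (- (real CARD('n) / 2 * inverse a))) \<longlongrightarrow> 0) (at_right 0)"
    by (intro filterlim_compose[OF exp_at_bot]) (simp add: filterlim_uminus_at_bot)
qed simp

text \<open>The substitution of 1/t for t turns the one-sided limit at 0 into a limit at
  infinity.\<close>

lemma integral_dominated_convergence_at_right_0:
  fixes s :: "real \<Rightarrow> 'a \<Rightarrow> real"
  assumes "f \<in> borel_measurable M" "\<And>t. s t \<in> borel_measurable M" "integrable M w"
    and lim: "AE x in M. ((\<lambda>t. s t x) \<longlongrightarrow> f x) (at_right 0)"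
    and bound: "\<forall>\<^sub>F t in at_right 0. AE x in M. norm (s t x) \<le> w x"
  shows "((\<lambda>t. integral\<^sup>L M (s t)) \<longlongrightarrow> integral\<^sup>L M f) (at_right 0)"
  unfolding filterlim_at_right_to_top
proof (rule integral_dominated_convergence_at_top)
  show "AE x in M. ((\<lambda>t. s (inverse t) x) \<longlongrightarrow> f x) at_top"
    using lim by (simp add: filterlim_at_right_to_top)
  show "\<forall>\<^sub>F t in at_top. AE x in M. norm (s (inverse t) x) \<le> w x"
    using bound by (simp add: eventually_at_right_to_top)
qed (use assms in auto)

text \<open>For \<open>S = {}\<close> the kernel at \<open>a = 0\<close> is the junk value given by \<open>x / 0 = 0\<close>, while its true limit is 0.\<close>
definition split_mass :: "'n::finite set \<Rightarrow> real" where
  "split_mass S = (if S = {} then 0 else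
     (1 / sqrt (2 * pi)) ^ CARD('n) / measure lborel (cball (0 :: real^'n) 1) * (LINT x|lborel. split_kernel S 0 x))"

text \<open>The test function may vary with a, so that scaled logarithms and their increments fit
  in. No limit of it is asked for when S is empty: there the kernel itself tends to 0 and
  boundedness is enough.\<close>

lemma gauss_split_integral_tendsto:
  fixes \<phi> :: "real \<Rightarrow> real^'n \<Rightarrow> real"
  assumes meas [measurable]: "\<And>a. \<phi> a \<in> borel_measurable borel"
    and bound: "\<forall>\<^sub>F a in at_right 0. \<forall>v\<in>kac_sphere. \<bar>\<phi> a v\<bar> \<le> C"
    and lim: "S \<noteq> {} \<Longrightarrow> AE x in lborel. ((\<lambda>a. \<phi> a (shrink_proj S a x)) \<longlongrightarrow> l) (at_right 0)"
  shows "((\<lambda>a. LINT v|sphere_unif. gauss_split S a v * \<phi> a v) \<longlongrightarrow> split_mass S * l) (at_right 0)"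
proof -
  define K where "K = (1 / sqrt (2 * pi)) ^ CARD('n) / measure lborel (cball (0 :: real^'n) 1)"
  have pos: "\<forall>\<^sub>F a :: real in at_right 0. a > 0"
    by (simp add: eventually_at_right_less)
  have ne: "AE x :: real^'n in lborel. x \<noteq> 0"
    by (rule AE_lborel_singleton)
  define g where "g x = (if S = {} then 0 else split_kernel S 0 x * l)" for x :: "real^'n"
  have bnd: "\<forall>\<^sub>F a in at_right 0. \<forall>x. x \<noteq> 0 \<longrightarrow>
     norm (split_kernel S a x * \<phi> a (shrink_proj S a x)) \<le> C * exp (- (real CARD('n) / 2 * (norm x)\<^sup>2))"
    using pos bound
  proof eventually_elim
    case (elim a)
    show ?case
    proof (intro allI impI)
      fix x :: "real^'n" assume x: "x \<noteq> 0"
      have "\<bar>\<phi> a (shrink_proj S a x)\<bar> \<le> C"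
        using elim shrink_proj_in_kac_sphere[OF _ x] by auto
      then have "split_kernel S a x * \<bar>\<phi> a (shrink_proj S a x)\<bar> \<le> exp (- (real CARD('n) / 2 * (norm x)\<^sup>2)) * C"
        using elim by (intro mult_mono split_kernel_le x) auto
      then show "norm (split_kernel S a x * \<phi> a (shrink_proj S a x)) \<le> C * exp (- (real CARD('n) / 2 * (norm x)\<^sup>2))"
        by (simp add: abs_mult mult.commute)
    qed
  qed
  have "((\<lambda>a. LINT x|lborel. split_kernel S a x * \<phi> a (shrink_proj S a x)) \<longlongrightarrow> (LINT x|lborel. g x)) (at_right 0)"
  proof (rule integral_dominated_convergence_at_right_0)
    show "integrable lborel (\<lambda>x :: real^'n. C * exp (- (real CARD('n) / 2 * (norm x)\<^sup>2)))"
      by (intro integrable_mult_right integrable_exp_norm_square) simp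
    show "\<forall>\<^sub>F a in at_right 0. AE x in lborel.
      norm (split_kernel S a x * \<phi> a (shrink_proj S a x)) \<le> C * exp (- (real CARD('n) / 2 * (norm x)\<^sup>2))"
      using bnd by eventually_elim (use ne in auto)
    show "AE x in lborel. ((\<lambda>a. split_kernel S a x * \<phi> a (shrink_proj S a x)) \<longlongrightarrow> g x) (at_right 0)"
    proof (cases "S = {}")
      case True
      show ?thesis using ne
      proof eventually_elim
        case (elim x)
        have "((\<lambda>a. split_kernel S a x * C) \<longlongrightarrow> 0 * C) (at_right 0)"
          using split_kernel_empty_tendsto[OF elim] True by (intro tendsto_intros) simp
        moreover have "\<forall>\<^sub>F a in at_right 0. norm (split_kernel S a x * \<phi> a (shrink_proj S a x)) \<le> split_kernel S a x * C"
          using pos bound by eventually_elim (use elim shrink_proj_in_kac_sphere in \<open>auto simp: abs_mult intro!: mult_left_mono\<close>)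
        ultimately show ?case
          using True by (auto simp: g_def intro: tendsto_0_le[where K=1] Lim_null_comparison)
      qed
    next
      case False
      show ?thesis
        using lim[OF False] AE_sqsum_pos[OF False] AE_sqsum_ne_1[of S]
        by eventually_elim (use False in \<open>auto simp: g_def intro!: tendsto_mult split_kernel_tendsto\<close>)
    qed
  qed (auto simp: g_def)
  then have *: "((\<lambda>a. K * (LINT x|lborel. split_kernel S a x * \<phi> a (shrink_proj S a x))) \<longlongrightarrow> K * (LINT x|lborel. g x)) (at_right 0)"
    by (rule tendsto_mult_left)
  have "K * (LINT x|lborel. g x) = split_mass S * l"
    by (simp add: g_def split_mass_def K_def)
  with * have "((\<lambda>a. K * (LINT x|lborel. split_kernel S a x * \<phi> a (shrink_proj S a x))) \<longlongrightarrow> split_mass S * l) (at_right 0)"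
    by simp
  then show ?thesis
    by (rule Lim_transform_eventually)
       (use pos in eventually_elim, simp add: sphere_integral_gauss_split K_def)
qed

section \<open>The chi-square constant\<close>

text \<open>Layer cake: the powers of the radius integrate by comparison with the volumes of all smaller balls.\<close>
lemma nn_integral_radius_power:
  fixes S :: "'i set"
  assumes S: "finite S" "S \<noteq> {}"
  shows "(\<integral>\<^sup>+f. indicator {..1} (sqrt (\<Sum>i\<in>S. (f i)\<^sup>2)) * ennreal (sqrt (\<Sum>i\<in>S. (f i)\<^sup>2) ^ m)
       \<partial>Pi\<^sub>M S (\<lambda>_. lborel)) = ennreal (unit_ball_vol (card S) * card S / (card S + m))"
proof -
  let ?P = "Pi\<^sub>M S (\<lambda>_. lborel :: real measure)"
  define k where "k = card S"
  define V where "V = unit_ball_vol (real k)"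
  have k: "k > 0" using S by (simp add: k_def card_gt_0_iff)
  have V: "V > 0" by (simp add: V_def)
  interpret product_sigma_finite "\<lambda>_ :: 'i. lborel :: real measure" by standard
  interpret F: finite_product_sigma_finite "\<lambda>_ :: 'i. lborel :: real measure" S by standard fact
  interpret pair_sigma_finite ?P "lborel :: real measure" by standard
  define \<rho> where "\<rho> f = sqrt (\<Sum>i\<in>S. (f i)\<^sup>2)" for f :: "'i \<Rightarrow> real"
  have [measurable]: "\<rho> \<in> borel_measurable ?P"
    unfolding \<rho>_def by measurable
  have \<rho>0: "\<rho> f \<ge> 0" for f by (simp add: \<rho>_def sum_nonneg)
  have ball: "(\<integral>\<^sup>+f. indicator {..r} (\<rho> f) \<partial>?P) = ennreal (V * r ^ k)" if "r \<ge> 0" for r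
  proof (cases "r = 0")
    \<comment> \<open>Radius 0 is treated apart: the ball is a singleton, hence null, and V * 0^k =
      0 because k > 0.\<close>
    case True
    have "(\<integral>\<^sup>+f. indicator {..0} (\<rho> f) \<partial>?P) = (\<integral>\<^sup>+f. indicator (Pi\<^sub>E S (\<lambda>_. {0})) f \<partial>?P)"
    proof (intro nn_integral_cong)
      fix f assume f: "f \<in> space ?P"
      have "\<rho> f \<le> 0 \<longleftrightarrow> (\<Sum>i\<in>S. (f i)\<^sup>2) = 0"
        using sum_nonneg[of S "\<lambda>i. (f i)\<^sup>2"] unfolding \<rho>_def real_sqrt_le_0_iff by fastforce
      also have "\<dots> \<longleftrightarrow> f \<in> Pi\<^sub>E S (\<lambda>_. {0})"
        using f S by (subst sum_nonneg_eq_0_iff) (auto simp: space_PiM PiE_iff extensional_def fun_eq_iff)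
      finally show "indicator {..0} (\<rho> f) = (indicator (Pi\<^sub>E S (\<lambda>_. {0})) f :: ennreal)"
        by (simp add: indicator_def)
    qed
    also have "\<dots> = emeasure ?P (Pi\<^sub>E S (\<lambda>_. {0}))"
      using S by (intro nn_integral_indicator sets_PiM_I_finite) auto
    also have "\<dots> = (\<Prod>i\<in>S. emeasure lborel {0 :: real})"
      using S by (intro emeasure_PiM) auto
    also have "\<dots> = 0" using S k by (simp add: k_def zero_power)
    finally show ?thesis using True k by (simp add: zero_power)
  next
    case False
    then have r: "r > 0" using that by simp
    have "(\<integral>\<^sup>+f. indicator {..r} (\<rho> f) \<partial>?P) = (\<integral>\<^sup>+f. indicator ({f. \<rho> f \<le> r} \<inter> space ?P) f \<partial>?P)"
      by (intro nn_integral_cong) (auto simp: indicator_def)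
    also have "\<dots> = emeasure ?P ({f. \<rho> f \<le> r} \<inter> space ?P)"
    proof (rule nn_integral_indicator)
      have "{f \<in> space ?P. \<rho> f \<le> r} \<in> sets ?P"
        by measurable
      then show "{f. \<rho> f \<le> r} \<inter> space ?P \<in> sets ?P"
        by (simp add: Int_def conj_commute)
    qed
    also have "\<dots> = ennreal (V * r ^ k)"
      using emeasure_cball_aux[OF S(1) r] by (simp add: \<rho>_def V_def k_def)
    finally show ?thesis .
  qed
  \<comment> \<open>On the unit ball the integral of m r^(m-1) from rho to 1 is 1 - rho^m. The
    truncated \<open>m - 1\<close> does no harm at m = 0, where the factor m vanishes.\<close>
  have pw: "indicator {..1} (\<rho> f) * ennreal (\<rho> f ^ m) + 
      (\<integral>\<^sup>+r. ennreal (m * r ^ (m - 1)) * indicator {0..1} r * indicator {..r} (\<rho> f) \<partial>lborel)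
      = indicator {..1} (\<rho> f)" for f
  proof -
    have "(\<integral>\<^sup>+r. ennreal (m * r ^ (m - 1)) * indicator {0..1} r * indicator {..r} (\<rho> f) \<partial>lborel) =
      (\<integral>\<^sup>+r. ennreal (m * r ^ (m - 1)) * indicator {\<rho> f..1} r \<partial>lborel)"
      using \<rho>0[of f] by (intro nn_integral_cong) (auto simp: indicator_def)
    also have "\<dots> = indicator {..1} (\<rho> f) * ennreal (1 - \<rho> f ^ m)"
    proof (cases "\<rho> f \<le> 1")
      case True
      have "(\<integral>\<^sup>+r. ennreal (m * r ^ (m - 1)) * indicator {\<rho> f..1} r \<partial>lborel) = ennreal (1 ^ m - \<rho> f ^ m)"
        using True \<rho>0[of f] by (intro nn_integral_FTC_Icc) (auto intro!: derivative_eq_intros)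
      then show ?thesis using True by simp
    qed simp
    finally show ?thesis
      using \<rho>0[of f] by (auto simp: indicator_def power_le_one simp flip: ennreal_plus)
  qed
  have ind: "indicator {..r} (\<rho> f) = (if \<rho> f \<le> r then 1 else (0 :: ennreal))" for r f
    by simp
  have [measurable]: "(\<lambda>(f, r). indicator {..r} (\<rho> f) :: ennreal) \<in> borel_measurable (?P \<Otimes>\<^sub>M lborel)"
    unfolding ind by measurable
  let ?X = "(\<integral>\<^sup>+f. indicator {..1} (\<rho> f) * ennreal (\<rho> f ^ m) \<partial>?P)"
  have "(\<integral>\<^sup>+f. (\<integral>\<^sup>+r. ennreal (m * r ^ (m - 1)) * indicator {0..1} r * indicator {..r} (\<rho> f) \<partial>lborel) \<partial>?P)
     = (\<integral>\<^sup>+r. (\<integral>\<^sup>+f. ennreal (m * r ^ (m - 1)) * indicator {0..1} r * indicator {..r} (\<rho> f) \<partial>?P) \<partial>lborel)"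
    by (rule Fubini'[symmetric]) measurable
  also have "\<dots> = (\<integral>\<^sup>+r. ennreal (V * m * r ^ (k + m - 1)) * indicator {0..1} r \<partial>lborel)"
  proof (intro nn_integral_cong)
    fix r :: real
    have "(\<integral>\<^sup>+f. ennreal (m * r ^ (m - 1)) * indicator {0..1} r * indicator {..r} (\<rho> f) \<partial>?P) =
      ennreal (m * r ^ (m - 1)) * indicator {0..1} r * (\<integral>\<^sup>+f. indicator {..r} (\<rho> f) \<partial>?P)"
      by (rule nn_integral_cmult) measurable
    also have "\<dots> = ennreal (V * m * r ^ (k + m - 1)) * indicator {0..1} r"
    proof (cases "r \<in> {0..1}")
      case True
      have e: "V * m * r ^ (k + m - 1) = (m * r ^ (m - 1)) * (V * r ^ k)"
        by (cases m) (auto simp: power_add)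
      have "r \<ge> 0" using True by simp
      then have "ennreal ((m * r ^ (m - 1)) * (V * r ^ k)) = ennreal (m * r ^ (m - 1)) * ennreal (V * r ^ k)"
        using V by (intro ennreal_mult mult_nonneg_nonneg) auto
      then show ?thesis
        unfolding e ball[OF \<open>r \<ge> 0\<close>] by (simp only: mult_ac)
    qed simp
    finally show "(\<integral>\<^sup>+f. ennreal (m * r ^ (m - 1)) * indicator {0..1} r * indicator {..r} (\<rho> f) \<partial>?P) =
       ennreal (V * m * r ^ (k + m - 1)) * indicator {0..1} r" .
  qed
  also have "\<dots> = ennreal (V * m / (k + m) * 1 ^ (k + m) - V * m / (k + m) * 0 ^ (k + m))"
  proof (rule nn_integral_FTC_Icc)
    fix r :: real
    have "((\<lambda>r. r ^ (k + m)) has_real_derivative real (k + m) * r ^ (k + m - 1)) (at r)"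
      using DERIV_pow[of "k + m" r] by simp
    from DERIV_cmult[OF this, of "V * m / (k + m)"] k
    show "((\<lambda>r. V * m / (k + m) * r ^ (k + m)) has_real_derivative V * m * r ^ (k + m - 1)) (at r)"
      by (simp add: mult.assoc)
  qed (use V in auto)
  finally have Y: "(\<integral>\<^sup>+f. (\<integral>\<^sup>+r. ennreal (m * r ^ (m - 1)) * indicator {0..1} r * indicator {..r} (\<rho> f) \<partial>lborel) \<partial>?P)
     = ennreal (V * m / (k + m))" using k by (simp add: zero_power)
  \<comment> \<open>The sought integral plus its complement is the volume V of the unit ball;
    cancelling the finite summand V m / (k + m) avoids a subtraction in
    \<open>ennreal\<close>.\<close>
  have "?X + ennreal (V * m / (k + m)) = (\<integral>\<^sup>+f. indicator {..1} (\<rho> f) * ennreal (\<rho> f ^ m) + 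
      (\<integral>\<^sup>+r. ennreal (m * r ^ (m - 1)) * indicator {0..1} r * indicator {..r} (\<rho> f) \<partial>lborel) \<partial>?P)"
    unfolding Y[symmetric] by (rule nn_integral_add[symmetric]) measurable
  also have "\<dots> = (\<integral>\<^sup>+f. indicator {..1} (\<rho> f) \<partial>?P)"
    by (simp only: pw)
  also have "\<dots> = ennreal V"
    using ball[of 1] by simp
  also have "\<dots> = ennreal (V * k / (k + m)) + ennreal (V * m / (k + m))"
    using V k by (subst ennreal_plus[symmetric])
      (auto simp: add_divide_distrib[symmetric] distrib_left[symmetric])
  finally have "?X = ennreal (V * k / (k + m))"
    unfolding add.commute[of _ "ennreal (V * m / (k + m))"] ennreal_add_left_cancel by simp
  then show ?thesis by (simp add: \<rho>_def V_def k_def)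
qed

text \<open>Fubini over S and its complement: the inner integral is a Gaussian one whose width is
  proportional to the radius of the S-part, which leaves that radius to the power
  \<open>card (-S)\<close> to be integrated over the unit ball of R^S.\<close>

lemma nn_integral_split_kernel_0:
  fixes S :: "'n::finite set"
  assumes S: "S \<noteq> {}"
  defines "N \<equiv> real CARD('n)"
  shows "(\<integral>\<^sup>+x. ennreal (split_kernel S 0 (x :: real^'n)) \<partial>lborel) =
    ennreal (exp (- (N / 2)) * sqrt (2 * pi / N) ^ card (-S) * (unit_ball_vol (card S) * card S / N))"
proof -
  let ?P = "\<lambda>I. Pi\<^sub>M I (\<lambda>_ :: 'n. lborel :: real measure)"
  interpret product_sigma_finite "\<lambda>_ :: 'n. lborel :: real measure" by standard
  have N: "N > 0" by (simp add: N_def)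
  have cardN: "card S + card (-S) = CARD('n)"
    using card_Un_disjoint[of S "-S"] by simp
  define q where "q I f = (\<Sum>i\<in>I. (f i)\<^sup>2)" for I and f :: "'n \<Rightarrow> real"
  have q0: "q I f \<ge> 0" for I f by (simp add: q_def sum_nonneg)
  have [measurable]: "q I \<in> borel_measurable (?P I)" for I
    unfolding q_def by measurable
  have [measurable]: "q I \<in> borel_measurable (?P (S \<union> -S))" for I
    unfolding q_def by measurable
  have [measurable]: "(\<lambda>f. \<chi> i. f i) \<in> measurable (?P UNIV) (borel :: (real^'n) measure)"
    by (rule borel_measurable_euclidean_space[THEN iffD2]) 
       (auto simp: Basis_vec_real inner_axis intro!: measurable_component_singleton)
  define k where "k f = ennreal (indicator {..1} (sqrt (q S f)) * exp (- (N / 2 * ((q S f + q (-S) f) / q S f))))" for f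
  have [measurable]: "k \<in> borel_measurable (?P (S \<union> -S))"
    unfolding k_def by measurable
  then have [measurable]: "k \<in> borel_measurable (?P UNIV)"
    by simp
  have kk: "ennreal (split_kernel S 0 (\<chi> i. f i)) = k f" for f
  proof -
    have q: "q I f = sqsum I (\<chi> i. f i)" for I by (simp add: q_def sqsum_def)
    have s: "(norm (shrink S 0 (\<chi> i. f i)))\<^sup>2 = q S f"
      by (simp add: norm_shrink q)
    then have "norm (shrink S 0 (\<chi> i. f i)) = sqrt (q S f)"
      by (metis norm_ge_zero real_sqrt_unique)
    then have "indicator (cball 0 1) (shrink S 0 (\<chi> i. f i)) = (indicator {..1} (sqrt (q S f)) :: real)"
      by (simp add: indicator_def)
    then show ?thesis
      unfolding split_kernel_def k_def s q sqsum_split by (simp add: N_def)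
  qed
  have inner: "(\<integral>\<^sup>+y. k (merge S (-S) (x, y)) \<partial>?P (-S)) = 
     ennreal (exp (- (N / 2)) * sqrt (2 * pi / N) ^ card (-S)) * 
       (indicator {..1} (sqrt (q S x)) * ennreal (sqrt (q S x) ^ card (-S)))" 
     if "q S x > 0" for x
  proof -
    have m: "q S (merge S (-S) (x, y)) = q S x" "q (-S) (merge S (-S) (x, y)) = q (-S) y" for y
      by (auto simp: q_def merge_def)
    \<comment> \<open>With the S-part x frozen, the exponent is N/2 plus c times the squared norm of
      the remaining coordinates.\<close>
    define c where "c = N / (2 * q S x)"
    have c: "c > 0" using N that by (simp add: c_def)
    have "k (merge S (-S) (x, y)) = ennreal (indicator {..1} (sqrt (q S x)) * exp (- (N / 2))) * 
       (\<Prod>i\<in>-S. ennreal (exp (- (c * (y i)\<^sup>2))))" for y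
    proof -
      have "N / 2 * ((q S x + q (-S) y) / q S x) = N / 2 + c * q (-S) y"
        using that by (simp add: c_def field_simps)
      moreover have "(\<Prod>i\<in>-S. ennreal (exp (- (c * (y i)\<^sup>2)))) = ennreal (exp (- (c * q (-S) y)))"
        by (simp add: prod_ennreal exp_sum[symmetric] q_def sum_distrib_left sum_negf)
      ultimately show ?thesis
        unfolding k_def m by (simp add: exp_add[symmetric] ennreal_mult[symmetric] mult.assoc)
    qed
    then have "(\<integral>\<^sup>+y. k (merge S (-S) (x, y)) \<partial>?P (-S)) = 
       ennreal (indicator {..1} (sqrt (q S x)) * exp (- (N / 2))) * 
        (\<integral>\<^sup>+y. (\<Prod>i\<in>-S. ennreal (exp (- (c * (y i)\<^sup>2)))) \<partial>?P (-S))"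
      by (simp add: nn_integral_cmult)
    also have "(\<integral>\<^sup>+y. (\<Prod>i\<in>-S. ennreal (exp (- (c * (y i)\<^sup>2)))) \<partial>?P (-S)) = ennreal (sqrt (pi / c) ^ card (-S))"
      using c by (subst product_nn_integral_prod) (auto simp: nn_integral_exp_square ennreal_power)
    also have "sqrt (pi / c) = sqrt (2 * pi / N) * sqrt (q S x)"
      by (simp add: c_def real_sqrt_mult[symmetric] mult_ac)
    finally show ?thesis
      using N q0 by (simp add: power_mult_distrib ennreal_mult mult_ac flip: ennreal_indicator)
  qed
  \<comment> \<open>The inner formula divides by \<open>q S x\<close>; its zero set is a single
    point of a product with at least one factor.\<close>
  have "AE x in ?P S. q S x > 0"
  proof (rule AE_I')
    have "emeasure (?P S) (Pi\<^sub>E S (\<lambda>_. {0})) = (\<Prod>i\<in>S. emeasure lborel {0 :: real})"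
      by (intro emeasure_PiM) auto
    also have "\<dots> = 0" using S by (simp add: zero_power card_gt_0_iff)
    finally show "Pi\<^sub>E S (\<lambda>_. {0}) \<in> null_sets (?P S)"
      by (intro null_setsI sets_PiM_I_finite) auto
    show "{x \<in> space (?P S). \<not> 0 < q S x} \<subseteq> Pi\<^sub>E S (\<lambda>_. {0})"
      using q0[of S] by (auto simp: q_def space_PiM PiE_def sum_nonneg_eq_0_iff not_less
        dest!: antisym intro: extensionalityI)
  qed
  have "(\<integral>\<^sup>+x. ennreal (split_kernel S 0 (x :: real^'n)) \<partial>lborel) = (\<integral>\<^sup>+f. k f \<partial>?P UNIV)"
    by (subst lborel_vec, subst nn_integral_distr) (auto simp: kk)
  also have "\<dots> = (\<integral>\<^sup>+f. k f \<partial>?P (S \<union> -S))" by simp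
  also have "\<dots> = (\<integral>\<^sup>+x. (\<integral>\<^sup>+y. k (merge S (-S) (x, y)) \<partial>?P (-S)) \<partial>?P S)"
    by (rule product_nn_integral_fold) auto
  also have "\<dots> = (\<integral>\<^sup>+x. ennreal (exp (- (N / 2)) * sqrt (2 * pi / N) ^ card (-S)) * 
       (indicator {..1} (sqrt (q S x)) * ennreal (sqrt (q S x) ^ card (-S))) \<partial>?P S)"
    by (rule nn_integral_cong_AE) (use \<open>AE x in ?P S. q S x > 0\<close> in eventually_elim, rule inner)
  also have "\<dots> = ennreal (exp (- (N / 2)) * sqrt (2 * pi / N) ^ card (-S)) * 
       (\<integral>\<^sup>+x. indicator {..1} (sqrt (q S x)) * ennreal (sqrt (q S x) ^ card (-S)) \<partial>?P S)"
    by (rule nn_integral_cmult) measurable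
  also have "(\<integral>\<^sup>+x. indicator {..1} (sqrt (q S x)) * ennreal (sqrt (q S x) ^ card (-S)) \<partial>?P S) =
      ennreal (unit_ball_vol (card S) * card S / (card S + card (-S)))"
    unfolding q_def by (rule nn_integral_radius_power) (use S in auto)
  also have "real (card S + card (-S)) = N"
    unfolding N_def cardN by simp
  finally show ?thesis
    using N by (subst ennreal_mult) simp_all
qed

text \<open>The factor in front does not depend on S, so it will cancel against the normalising
  constant. For empty S both sides are 0, the right one by the convention
  \<open>Gamma 0 = 0\<close>.\<close>

lemma split_mass_eq:
  fixes S :: "'n::finite set"
  shows "split_mass S = 2 / (measure lborel (cball (0 :: real^'n) 1) * sqrt (real CARD('n)) ^ CARD('n)) *
     chi_square_density (card S) (real CARD('n))"
proof (cases "S = {}")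
  case True
  then show ?thesis by (simp add: split_mass_def chi_square_density_def)
next
  case False
  define N where "N = CARD('n)"
  define k where "k = card S"
  define \<beta> where "\<beta> = measure lborel (cball (0 :: real^'n) 1)"
  have N: "N > 0" by (simp add: N_def)
  have k: "k > 0" using False by (simp add: k_def card_gt_0_iff)
  have kN: "card (-S) = N - k" "k \<le> N"
    using card_Un_disjoint[of S "-S"] by (auto simp: N_def k_def)
  have G: "Gamma (real k / 2) > 0" using k by (simp add: Gamma_real_pos)
  have "(LINT x|lborel. split_kernel S 0 (x :: real^'n)) =
     exp (- (N / 2)) * sqrt (2 * pi / N) ^ card (-S) * (unit_ball_vol k * k / N)"
    by (subst integral_eq_nn_integral)
       (auto simp: nn_integral_split_kernel_0[OF False] k_def N_def)
  \<comment> \<open>This is the area of the unit sphere of R^k; it supplies the Gamma factor of the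
    chi-square density.\<close>
  moreover have "unit_ball_vol k * k = 2 * sqrt pi ^ k / Gamma (real k / 2)"
  proof -
    have G1: "Gamma (real k / 2 + 1) = real k / 2 * Gamma (real k / 2)"
      using k by (intro Gamma_plus1) (auto dest: nonpos_Ints_nonpos)
    show ?thesis
      unfolding unit_ball_vol_def G1 using k by (simp add: powr_half_sqrt_powr powr_realpow real_sqrt_power)
  qed
  moreover have "chi_square_density k (real N) = sqrt N ^ k / N * exp (- (N / 2)) / (sqrt 2 ^ k * Gamma (real k / 2))"
    using N by (simp add: chi_square_density_def powr_diff powr_half_sqrt_powr powr_realpow real_sqrt_power)
  \<comment> \<open>All powers of pi cancel; beside the powers of N and 2 found in the chi-square
    density, only N^(-N/2) is left.\<close>
  moreover have "(1 / sqrt (2 * pi)) ^ N * sqrt (2 * pi / N) ^ (N - k) * sqrt pi ^ k = sqrt N ^ k / (sqrt N ^ N * sqrt 2 ^ k)"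
  proof -
    have "(1 / sqrt (2 * pi)) ^ N = (1 / sqrt (2 * pi)) ^ (N - k) * (1 / sqrt (2 * pi)) ^ k"
      using kN by (simp flip: power_add)
    moreover have "sqrt N ^ N = sqrt N ^ (N - k) * sqrt N ^ k"
      using kN by (simp flip: power_add)
    ultimately show ?thesis using N
      by (simp add: real_sqrt_divide real_sqrt_mult power_divide power_mult_distrib field_simps)
  qed
  ultimately have eqs: "(LINT x|lborel. split_kernel S 0 (x :: real^'n)) =
     exp (- (N / 2)) * sqrt (2 * pi / N) ^ (N - k) * (2 * sqrt pi ^ k / Gamma (real k / 2) / N)"
    "chi_square_density k (real N) = sqrt N ^ k / N * exp (- (N / 2)) / (sqrt 2 ^ k * Gamma (real k / 2))"
    "(1 / sqrt (2 * pi)) ^ N * sqrt (2 * pi / N) ^ (N - k) * sqrt pi ^ k = sqrt N ^ k / (sqrt N ^ N * sqrt 2 ^ k)"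
    unfolding kN by simp_all
  have "split_mass S = 1 / \<beta> * (2 / (N * Gamma (real k / 2)) * exp (- (N / 2))) *
     ((1 / sqrt (2 * pi)) ^ N * sqrt (2 * pi / N) ^ (N - k) * sqrt pi ^ k)"
    using False unfolding split_mass_def eqs(1) N_def[symmetric] \<beta>_def[symmetric] by (simp add: mult_ac)
  also have "\<dots> = 2 / (\<beta> * sqrt N ^ N) * chi_square_density k N"
    unfolding eqs(2,3) by (simp add: mult_ac)
  finally show ?thesis by (simp add: \<beta>_def N_def k_def)
qed

section \<open>The logarithm of the mixture\<close>

lemma gauss_nonneg [simp]: "gauss s x \<ge> 0"
  by (simp add: gauss_def)

lemma gauss_le: "s > 0 \<Longrightarrow> gauss s x \<le> 1 / sqrt s"
proof -
  assume s: "s > 0"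
  have "sqrt s \<le> sqrt (2 * pi * s)"
    using s pi_ge_two by (intro real_sqrt_le_mono) (simp add: mult_le_cancel_right1)
  then have "1 / sqrt (2 * pi * s) \<le> 1 / sqrt s"
    using s by (intro divide_left_mono) auto
  moreover have "exp (- (x\<^sup>2) / (2 * s)) \<le> 1"
    using s by simp
  ultimately have "1 / sqrt (2 * pi * s) * exp (- (x\<^sup>2) / (2 * s)) \<le> 1 / sqrt s * 1"
    using s by (intro mult_mono) auto
  then show ?thesis using s by (simp add: gauss_eq)
qed

definition mix_log :: "real \<Rightarrow> real \<Rightarrow> real \<Rightarrow> real" where
  "mix_log a \<delta> x = ln (gauss_mix a \<delta> x) / ln (1 / a)"

lemma measurable_gauss_mix [measurable]: "gauss_mix a \<delta> \<in> borel_measurable borel"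
  unfolding gauss_mix_def gauss_def normal_density_def by measurable

lemma measurable_mix_log [measurable]: "mix_log a \<delta> \<in> borel_measurable borel"
  unfolding mix_log_def by measurable

lemma measurable_mix_prod [measurable]: "(mix_prod a \<delta> :: real^'n \<Rightarrow> real) \<in> borel_measurable borel"
  unfolding mix_prod_def by measurable

lemma ln_inverse_at_top: "filterlim (\<lambda>a::real. ln (1 / a)) at_top (at_right 0)"
  unfolding divide_inverse mult_1
  by (rule filterlim_compose[OF ln_at_top filterlim_inverse_at_top_right])

context
  fixes \<delta> :: real
  assumes \<delta>: "0 < \<delta>" "\<delta> < 1"
begin

lemma gauss_mix_pos: "a > 0 \<Longrightarrow> gauss_mix a \<delta> x > 0"
  using \<delta> by (auto simp: gauss_mix_def gauss_def normal_density_pos intro!: add_pos_pos mult_pos_pos)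

text \<open>Having no constant in front of 1 / sqrt a makes the bound 1/2 on \<open>mix_log\<close>
  exact, without an error term.\<close>

lemma gauss_mix_le:
  assumes "0 < a" "a < 1"
  shows "gauss_mix a \<delta> x \<le> 1 / sqrt a"
proof -
  have "1 \<le> 1 / sqrt a" using assms by simp
  with gauss_le[of 1 x] have "gauss 1 x \<le> 1 / sqrt a" by simp
  then have "gauss_mix a \<delta> x \<le> (1 - \<delta>) * (1 / sqrt a) + \<delta> * (1 / sqrt a)"
    unfolding gauss_mix_def using \<delta> assms by (intro add_mono mult_left_mono gauss_le) auto
  also have "\<dots> = 1 / sqrt a"
    by (simp only: distrib_right[symmetric]) simp
  finally show ?thesis .
qed

text \<open>Only the component of variance 1 is kept, so the lower bound is uniform in a.\<close>

lemma gauss_mix_ge: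
  assumes "0 < a" "x\<^sup>2 \<le> r"
  shows "\<delta> * gauss 1 (sqrt r) \<le> gauss_mix a \<delta> x"
proof -
  have "r \<ge> 0" using assms(2) zero_le_power2[of x] by linarith
  then have "gauss 1 (sqrt r) \<le> gauss 1 x"
    using assms by (auto simp: gauss_eq intro!: divide_right_mono)
  then have "\<delta> * gauss 1 (sqrt r) \<le> \<delta> * gauss 1 x"
    using \<delta> by (intro mult_left_mono) auto
  also have "\<dots> \<le> gauss_mix a \<delta> x"
    using \<delta> by (simp add: gauss_mix_def)
  finally show ?thesis .
qed

lemma mix_log_le_half:
  assumes "0 < a" "a < 1"
  shows "mix_log a \<delta> x \<le> 1 / 2"
proof -
  have "ln (gauss_mix a \<delta> x) \<le> ln (1 / sqrt a)"
    using assms gauss_mix_le[OF assms] gauss_mix_pos[of a x] by (subst ln_le_cancel_iff) auto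
  also have "\<dots> = ln (1 / a) / 2"
    using assms by (simp add: ln_div ln_sqrt)
  finally show ?thesis
    using assms by (simp add: mix_log_def divide_le_eq)
qed

lemma mix_log_ge:
  assumes "0 < a" "a < 1" "x\<^sup>2 \<le> r"
  shows "ln (\<delta> * gauss 1 (sqrt r)) / ln (1 / a) \<le> mix_log a \<delta> x"
proof -
  have "gauss 1 (sqrt r) > 0" by (simp add: gauss_def normal_density_pos)
  then have "ln (\<delta> * gauss 1 (sqrt r)) \<le> ln (gauss_mix a \<delta> x)"
    using \<delta> assms gauss_mix_ge[OF assms(1,3)] gauss_mix_pos[of a x] by (subst ln_le_cancel_iff) auto
  then show ?thesis
    using assms unfolding mix_log_def by (intro divide_right_mono) auto
qed

lemma mix_log_bounded: "\<exists>C. \<forall>\<^sub>F a in at_right 0. \<forall>x. x\<^sup>2 \<le> r \<longrightarrow> \<bar>mix_log a \<delta> x\<bar> \<le> C"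
proof -
  define c where "c = \<bar>ln (\<delta> * gauss 1 (sqrt r))\<bar>"
  have "\<forall>\<^sub>F a :: real in at_right 0. 1 \<le> ln (1 / a)"
    using ln_inverse_at_top by (simp add: filterlim_at_top)
  then have "\<forall>\<^sub>F a in at_right 0. \<forall>x. x\<^sup>2 \<le> r \<longrightarrow> \<bar>mix_log a \<delta> x\<bar> \<le> c + 1 / 2"
    using eventually_at_right_0_less[OF zero_less_one]
  proof eventually_elim
    case (elim a)
    show ?case
    proof (intro allI impI)
      fix x :: real assume x: "x\<^sup>2 \<le> r"
      have "\<bar>ln (\<delta> * gauss 1 (sqrt r)) / ln (1 / a)\<bar> = c / ln (1 / a)"
        unfolding abs_divide c_def using elim by simp
      also have "\<dots> \<le> c / 1"
        using elim by (intro divide_left_mono) (auto simp: c_def)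
      finally have "\<bar>ln (\<delta> * gauss 1 (sqrt r)) / ln (1 / a)\<bar> \<le> c"
        by simp
      with mix_log_ge[OF _ _ x, of a] mix_log_le_half[of a x] elim
      show "\<bar>mix_log a \<delta> x\<bar> \<le> c + 1 / 2"
        by linarith
    qed
  qed
  then show ?thesis by blast
qed

text \<open>At a point staying away from 0 the narrow Gaussian is eventually at most 1, so the
  logarithm is at most 0; from below it is a constant, which the division by ln (1/a) sends to
  0.\<close>

lemma mix_log_tendsto_0:
  assumes w: "(w \<longlongrightarrow> L) (at_right 0)" and L: "L \<noteq> 0" and r: "\<forall>\<^sub>F a in at_right 0. (w a)\<^sup>2 \<le> r"
  shows "((\<lambda>a. mix_log a \<delta> (w a)) \<longlongrightarrow> 0) (at_right 0)"
proof (rule tendsto_sandwich)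
  show "\<forall>\<^sub>F a in at_right 0. ln (\<delta> * gauss 1 (sqrt r)) / ln (1 / a) \<le> mix_log a \<delta> (w a)"
    using r eventually_at_right_0_less[OF zero_less_one] by eventually_elim (rule mix_log_ge; simp)
  show "((\<lambda>a. ln (\<delta> * gauss 1 (sqrt r)) / ln (1 / a)) \<longlongrightarrow> 0) (at_right 0)"
    by (rule real_tendsto_divide_at_top[OF tendsto_const ln_inverse_at_top])
  have "((\<lambda>a. (w a)\<^sup>2) \<longlongrightarrow> L\<^sup>2) (at_right 0)"
    by (intro tendsto_intros w)
  moreover have "L\<^sup>2 / 2 < L\<^sup>2" using L by simp
  ultimately have w2: "\<forall>\<^sub>F a in at_right 0. L\<^sup>2 / 2 < (w a)\<^sup>2"
    by (rule order_tendstoD)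
  have L2: "L\<^sup>2 > 0" using L by simp
  \<comment> \<open>With u = L^2/(4a) and exp(-u) <= 1/u, the quantity a^(-1/2) exp(-u) is at most 4
    sqrt a / L^2, which is at most 1 below this threshold.\<close>
  then have "(L\<^sup>2 / 4)\<^sup>2 > 0" by simp
  from eventually_at_right_0_less[OF this]
  have "\<forall>\<^sub>F a in at_right 0. 1 / sqrt a * exp (- (L\<^sup>2) / (4 * a)) \<le> 1"
  proof eventually_elim
    case (elim a)
    define u where "u = L\<^sup>2 / (4 * a)"
    define s where "s = sqrt a"
    have u: "u > 0" using elim L2 by (simp add: u_def)
    have s: "s > 0" "a = s * s" using elim by (auto simp: s_def)
    have "u \<le> exp u"
      using exp_ge_add_one_self[of u] by linarith
    then have "inverse (exp u) \<le> inverse u"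
      using u by (rule le_imp_inverse_le)
    then have "1 / s * exp (- u) \<le> 1 / s * inverse u"
      using s by (intro mult_left_mono) (auto simp: exp_minus)
    also have "\<dots> = s / (L\<^sup>2 / 4)"
      unfolding u_def s(2) using s(1) L2 by simp
    finally have "1 / sqrt a * exp (- (L\<^sup>2) / (4 * a)) \<le> sqrt a / (L\<^sup>2 / 4)"
      by (simp add: u_def s_def)
    also have "\<dots> \<le> 1"
    proof -
      have "sqrt a \<le> sqrt ((L\<^sup>2 / 4)\<^sup>2)"
        using elim by (intro real_sqrt_le_mono) simp
      then have "sqrt a \<le> L\<^sup>2 / 4" using L2 by simp
      then show ?thesis using L2 by simp
    qed
    finally show ?case .
  qed
  then have "\<forall>\<^sub>F a in at_right 0. gauss_mix a \<delta> (w a) \<le> 1"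
    using w2 eventually_at_right_0_less[OF zero_less_one]
  proof eventually_elim
    case (elim a)
    have "gauss a (w a) = 1 / sqrt (2 * pi) * (1 / sqrt a) * exp (- ((w a)\<^sup>2) / (2 * a))"
      using elim by (simp add: gauss_eq real_sqrt_mult)
    also have "\<dots> \<le> 1 * (1 / sqrt a) * exp (- (L\<^sup>2) / (4 * a))"
    proof (intro mult_mono)
      have "1 \<le> sqrt (2 * pi)" using pi_ge_two by simp
      then show "1 / sqrt (2 * pi) \<le> 1" by (simp add: divide_le_eq)
      have "L\<^sup>2 / (4 * a) = L\<^sup>2 / 2 / (2 * a)" by simp
      also have "\<dots> \<le> (w a)\<^sup>2 / (2 * a)"
        using elim by (intro divide_right_mono) auto
      finally show "exp (- ((w a)\<^sup>2) / (2 * a)) \<le> exp (- (L\<^sup>2) / (4 * a))"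
        by simp
    qed (use elim in auto)
    finally have "gauss a (w a) \<le> 1" using elim by linarith
    then have "gauss_mix a \<delta> (w a) \<le> (1 - \<delta>) * 1 + \<delta> * 1"
      unfolding gauss_mix_def using \<delta> gauss_le[of 1 "w a"] by (intro add_mono mult_left_mono) auto
    then show ?case by simp
  qed
  then show "\<forall>\<^sub>F a in at_right 0. mix_log a \<delta> (w a) \<le> 0"
    using eventually_at_right_0_less[OF zero_less_one]
  proof eventually_elim
    case (elim a)
    then show ?case
      using gauss_mix_pos[of a "w a"] unfolding mix_log_def by (intro divide_nonpos_nonneg) simp_all
  qed
qed simp

text \<open>The narrow component alone has logarithm ln (1/a) / 2 plus a term that converges when w
  is of order sqrt a; the matching upper bound is \<open>mix_log_le_half\<close>.\<close>

lemma mix_log_tendsto_half: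
  assumes w: "((\<lambda>a. w a / sqrt a) \<longlongrightarrow> L) (at_right 0)"
  shows "((\<lambda>a. mix_log a \<delta> (w a)) \<longlongrightarrow> 1 / 2) (at_right 0)"
proof (rule tendsto_sandwich)
  define c where "c = ln ((1 - \<delta>) / sqrt (2 * pi))"
  show "\<forall>\<^sub>F a in at_right 0. mix_log a \<delta> (w a) \<le> 1 / 2"
    using eventually_at_right_0_less[OF zero_less_one] by eventually_elim (rule mix_log_le_half; simp)
  show "\<forall>\<^sub>F a in at_right 0. 1 / 2 + (c - (w a / sqrt a)\<^sup>2 / 2) / ln (1 / a) \<le> mix_log a \<delta> (w a)"
    using eventually_at_right_0_less[OF zero_less_one]
  proof eventually_elim
    case (elim a)
    have "(1 - \<delta>) / sqrt (2 * pi) * (1 / sqrt a) * exp (- ((w a / sqrt a)\<^sup>2 / 2)) = (1 - \<delta>) * gauss a (w a)"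
      using elim by (simp add: gauss_eq real_sqrt_mult power_divide)
    also have "\<dots> \<le> gauss_mix a \<delta> (w a)"
      using \<delta> by (simp add: gauss_mix_def)
    finally have "ln ((1 - \<delta>) / sqrt (2 * pi) * (1 / sqrt a) * exp (- ((w a / sqrt a)\<^sup>2 / 2))) \<le> ln (gauss_mix a \<delta> (w a))"
      using elim \<delta> gauss_mix_pos[of a] by (subst ln_le_cancel_iff) auto
    moreover have "ln ((1 - \<delta>) / sqrt (2 * pi) * (1 / sqrt a) * exp (- ((w a / sqrt a)\<^sup>2 / 2))) =
        c + ln (1 / a) / 2 - (w a / sqrt a)\<^sup>2 / 2"
    proof -
      have "(1 - \<delta>) / sqrt (2 * pi) > 0" "1 / sqrt a > 0"
        using elim \<delta> by auto
      then have "ln ((1 - \<delta>) / sqrt (2 * pi) * (1 / sqrt a) * exp (- ((w a / sqrt a)\<^sup>2 / 2))) =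
          c + ln (1 / sqrt a) - (w a / sqrt a)\<^sup>2 / 2"
        unfolding c_def by (simp only: ln_mult_pos mult_pos_pos exp_gt_zero ln_exp)
      also have "ln (1 / sqrt a) = ln (1 / a) / 2"
        using elim by (simp add: ln_div ln_sqrt)
      finally show ?thesis .
    qed
    ultimately have "(c + ln (1 / a) / 2 - (w a / sqrt a)\<^sup>2 / 2) / ln (1 / a) \<le> mix_log a \<delta> (w a)"
      unfolding mix_log_def using elim by (intro divide_right_mono) auto
    moreover have "(c + ln (1 / a) / 2 - (w a / sqrt a)\<^sup>2 / 2) / ln (1 / a) = 1 / 2 + (c - (w a / sqrt a)\<^sup>2 / 2) / ln (1 / a)"
      using elim by (simp add: add_divide_distrib diff_divide_distrib)
    ultimately show ?case by simp
  qed
  have "((\<lambda>a. c - (w a / sqrt a)\<^sup>2 / 2) \<longlongrightarrow> c - L\<^sup>2 / 2) (at_right 0)"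
    by (intro tendsto_intros w) simp
  then have "((\<lambda>a. (c - (w a / sqrt a)\<^sup>2 / 2) / ln (1 / a)) \<longlongrightarrow> 0) (at_right 0)"
    by (rule real_tendsto_divide_at_top[OF _ ln_inverse_at_top])
  from tendsto_add[OF tendsto_const this, of "1 / 2"]
  show "((\<lambda>a. 1 / 2 + (c - (w a / sqrt a)\<^sup>2 / 2) / ln (1 / a)) \<longlongrightarrow> 1 / 2) (at_right 0)"
    by simp
qed simp

lemma mix_prod_expand:
  "mix_prod a \<delta> (v :: real^'n) = (\<Sum>S\<in>UNIV. \<delta> ^ card S * (1 - \<delta>) ^ (CARD('n) - card S) * gauss_split S a v)"
proof -
  have "mix_prod a \<delta> v = (\<Prod>i\<in>UNIV. \<delta> * gauss 1 (v $ i) + (1 - \<delta>) * gauss a (v $ i))"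
    by (simp add: mix_prod_def gauss_mix_def add.commute)
  also have "\<dots> = (\<Sum>S\<in>Pow UNIV. (\<Prod>i\<in>S. \<delta> * gauss 1 (v $ i)) * (\<Prod>i\<in>UNIV - S. (1 - \<delta>) * gauss a (v $ i)))"
    by (rule prod_add) simp
  also have "\<dots> = (\<Sum>S\<in>UNIV. \<delta> ^ card S * (1 - \<delta>) ^ (CARD('n) - card S) * gauss_split S a v)"
    by (intro sum.cong)
       (auto simp: prod.distrib gauss_split_def card_Diff_subset Compl_eq_Diff_UNIV)
  finally show ?thesis .
qed

end

section \<open>Averages under the mixture: from sets S to the law of K\<close>

lemma sum_card_subsets:
  fixes h :: "nat \<Rightarrow> 'b::comm_semiring_1"
  assumes "finite A"
  shows "(\<Sum>S\<in>Pow A. h (card S)) = (\<Sum>k\<le>card A. of_nat (card A choose k) * h k)"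
proof -
  have "(\<Sum>S\<in>Pow A. h (card S)) = (\<Sum>k\<le>card A. \<Sum>S | S \<in> Pow A \<and> card S = k. h (card S))"
    using assms by (intro sum.group[symmetric]) (auto intro: card_mono)
  also have "\<dots> = (\<Sum>k\<le>card A. of_nat (card A choose k) * h k)"
    using assms by (intro sum.cong refl) (simp add: n_subsets)
  finally show ?thesis .
qed

lemma gauss_split_nonneg: "gauss_split S a v \<ge> 0"
  by (auto simp: gauss_split_def intro!: mult_nonneg_nonneg prod_nonneg)

lemma gauss_split_le:
  assumes "0 < a" "a < 1"
  shows "gauss_split S a (v :: real^'n) \<le> (1 / sqrt a) ^ card (-S)"
proof -
  have "(\<Prod>i\<in>S. gauss 1 (v $ i)) \<le> (\<Prod>i\<in>S. 1)"
    using gauss_le[of 1] by (intro prod_mono) auto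
  moreover have "(\<Prod>i\<in>-S. gauss a (v $ i)) \<le> (\<Prod>i\<in>-S. 1 / sqrt a)"
    using gauss_le[of a] assms by (intro prod_mono) auto
  ultimately have "gauss_split S a v \<le> 1 * (1 / sqrt a) ^ card (-S)"
    unfolding gauss_split_def by (intro mult_mono) (auto intro!: prod_nonneg)
  then show ?thesis by simp
qed

text \<open>A bound on the sphere suffices because the measure is carried by it;
  \<open>mix_log\<close> is unbounded elsewhere.\<close>

lemma integrable_sphere_bounded:
  fixes f :: "real^'n \<Rightarrow> real"
  assumes [measurable]: "f \<in> borel_measurable borel" and "\<And>v. v \<in> kac_sphere \<Longrightarrow> \<bar>f v\<bar> \<le> C"
  shows "integrable sphere_unif f"
proof -
  interpret prob_space "sphere_unif :: (real^'n) measure"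
    by (rule prob_space_sphere_unif)
  show ?thesis
    by (rule integrable_const_bound[where B=C]) (use AE_sphere_unif in \<open>eventually_elim, simp add: assms(2)\<close>, measurable)
qed

text \<open>\<open>Gamma 0 = 0\<close> and \<open>x / 0 = 0\<close> make the density with no degree of freedom vanish.\<close>
lemma K_weight_0 [simp]: "K_weight N \<delta> 0 = 0"
  by (simp add: K_weight_def chi_square_density_def)

text \<open>The limit of the test function may depend on S through its cardinality only; sets of
  equal size then merge, and their number is the binomial coefficient of
  \<open>K_weight\<close>.\<close>

lemma mix_prod_integral_tendsto:
  fixes \<phi> :: "real \<Rightarrow> real^'n \<Rightarrow> real"
  assumes \<delta>: "0 < \<delta>" "\<delta> < 1"
    and meas [measurable]: "\<And>a. \<phi> a \<in> borel_measurable borel"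
    and bound: "\<forall>\<^sub>F a in at_right 0. \<forall>v\<in>kac_sphere. \<bar>\<phi> a v\<bar> \<le> C"
    and lim: "\<And>S. S \<noteq> {} \<Longrightarrow> AE x in lborel. ((\<lambda>a. \<phi> a (shrink_proj S a x)) \<longlongrightarrow> g (card S)) (at_right 0)"
  shows "((\<lambda>a. LINT v|sphere_unif. mix_prod a \<delta> v * \<phi> a v) \<longlongrightarrow> 
     2 / (measure lborel (cball (0 :: real^'n) 1) * sqrt (real CARD('n)) ^ CARD('n)) *
       (\<Sum>k=1..CARD('n). g k * K_weight CARD('n) \<delta> k)) (at_right 0)"
proof -
  define W where "W k = \<delta> ^ k * (1 - \<delta>) ^ (CARD('n) - k)" for k
  define \<kappa> where "\<kappa> = 2 / (measure lborel (cball (0 :: real^'n) 1) * sqrt (real CARD('n)) ^ CARD('n))"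
  have "((\<lambda>a. \<Sum>S\<in>UNIV. W (card S) * (LINT v|sphere_unif. gauss_split S a v * \<phi> a v)) \<longlongrightarrow> 
      (\<Sum>S\<in>UNIV. W (card (S :: 'n set)) * (split_mass S * g (card S)))) (at_right 0)"
    by (intro tendsto_sum tendsto_mult_left gauss_split_integral_tendsto[where C=C] bound lim meas)
  moreover have "\<forall>\<^sub>F a in at_right 0. (\<Sum>S\<in>UNIV. W (card S) * (LINT v|sphere_unif. gauss_split S a v * \<phi> a v)) =
      (LINT v|sphere_unif. mix_prod a \<delta> v * \<phi> a v)"
    using bound eventually_at_right_0_less[OF zero_less_one]
  proof eventually_elim
    case (elim a)
    have int: "integrable sphere_unif (\<lambda>v. gauss_split S a v * \<phi> a v)" for S
    proof (rule integrable_sphere_bounded)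
      fix v :: "real^'n" assume "v \<in> kac_sphere"
      then show "\<bar>gauss_split S a v * \<phi> a v\<bar> \<le> (1 / sqrt a) ^ card (-S) * C"
        unfolding abs_mult using elim
        by (intro mult_mono) (auto simp: gauss_split_nonneg gauss_split_le)
    qed measurable
    have "(LINT v|sphere_unif. mix_prod a \<delta> v * \<phi> a v) =
        (LINT v|sphere_unif. (\<Sum>S\<in>UNIV. W (card S) * (gauss_split S a v * \<phi> a v)))"
      unfolding mix_prod_expand[OF \<delta>] W_def by (simp add: sum_distrib_right mult.assoc)
    also have "\<dots> = (\<Sum>S\<in>UNIV. W (card S) * (LINT v|sphere_unif. gauss_split S a v * \<phi> a v))"
      using int by (subst Bochner_Integration.integral_sum) auto
    finally show ?case ..
  qed
  ultimately have "((\<lambda>a. LINT v|sphere_unif. mix_prod a \<delta> v * \<phi> a v) \<longlongrightarrow> 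
      (\<Sum>S\<in>UNIV. W (card (S :: 'n set)) * (split_mass S * g (card S)))) (at_right 0)"
    by (rule Lim_transform_eventually)
  also have "(\<Sum>S\<in>UNIV. W (card (S :: 'n set)) * (split_mass S * g (card S))) = 
      (\<Sum>S\<in>Pow (UNIV :: 'n set). W (card S) * (\<kappa> * chi_square_density (card S) CARD('n) * g (card S)))"
    by (simp add: split_mass_eq \<kappa>_def)
  also have "\<dots> = (\<Sum>k\<le>CARD('n). real (CARD('n) choose k) * (W k * (\<kappa> * chi_square_density k CARD('n) * g k)))"
    by (rule sum_card_subsets) simp
  also have "\<dots> = (\<Sum>k\<le>CARD('n). \<kappa> * (g k * K_weight CARD('n) \<delta> k))"
    by (intro sum.cong) (auto simp: W_def K_weight_def mult_ac)
  \<comment> \<open>The empty set drops out by \<open>K_weight_0\<close>.\<close>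
  also have "\<dots> = (\<Sum>k=1..CARD('n). \<kappa> * (g k * K_weight CARD('n) \<delta> k))"
    by (intro sum.mono_neutral_right) (auto simp: Suc_le_eq)
  also have "\<dots> = \<kappa> * (\<Sum>k=1..CARD('n). g k * K_weight CARD('n) \<delta> k)"
    by (rule sum_distrib_left[symmetric])
  finally show ?thesis by (simp add: \<kappa>_def)
qed

lemma sum_K_weight_pos:
  assumes "N \<ge> 1" "0 < \<delta>" "\<delta> < 1"
  shows "(\<Sum>k=1..N. K_weight N \<delta> k) > 0"
proof -
  \<comment> \<open>Were the sum 0, every \<open>K_prob\<close> would be 0 by
    \<open>x / 0 = 0\<close>, against total mass 1.\<close>
  have "(\<Sum>k=1..N. K_weight N \<delta> k) \<noteq> 0"
    using K_prob_distribution(2)[OF assms] by (auto simp: K_prob_def)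
  moreover have "K_weight N \<delta> k \<ge> 0" for k
    using assms by (cases "k = 0") (auto simp: K_weight_def chi_square_density_def Gamma_real_pos less_imp_le)
  then have "(\<Sum>k=1..N. K_weight N \<delta> k) \<ge> 0"
    by (intro sum_nonneg)
  ultimately show ?thesis by linarith
qed

lemma mix_prod_mass_tendsto:
  assumes \<delta>: "0 < \<delta>" "\<delta> < 1"
  shows "((\<lambda>a. LINT v|sphere_unif. mix_prod a \<delta> (v :: real^'n)) \<longlongrightarrow> 
     2 / (measure lborel (cball (0 :: real^'n) 1) * sqrt (real CARD('n)) ^ CARD('n)) *
       (\<Sum>k=1..CARD('n). K_weight CARD('n) \<delta> k)) (at_right 0)"
  using mix_prod_integral_tendsto[OF \<delta>, of "\<lambda>_ _. 1" 1 "\<lambda>_. 1"] by simp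

lemma mix_mass_limit_pos:
  assumes \<delta>: "0 < \<delta>" "\<delta> < 1"
  shows "2 / (measure lborel (cball (0 :: real^'n) 1) * sqrt (real CARD('n)) ^ CARD('n)) *
       (\<Sum>k=1..CARD('n). K_weight CARD('n) \<delta> k) > 0"
  using content_cball_pos[of 1 "0 :: real^'n"] sum_K_weight_pos[OF _ \<delta>, of "CARD('n)"]
  by (auto intro!: mult_pos_pos divide_pos_pos simp: Suc_le_eq)

text \<open>Numerator and normalising constant share the factor that depends on N only, so their
  quotient is an expectation under the law of K.\<close>

lemma mix_density_integral_tendsto:
  fixes \<phi> :: "real \<Rightarrow> real^'n \<Rightarrow> real"
  assumes \<delta>: "0 < \<delta>" "\<delta> < 1"
    and meas [measurable]: "\<And>a. \<phi> a \<in> borel_measurable borel"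
    and bound: "\<forall>\<^sub>F a in at_right 0. \<forall>v\<in>kac_sphere. \<bar>\<phi> a v\<bar> \<le> C"
    and lim: "\<And>S. S \<noteq> {} \<Longrightarrow> AE x in lborel. ((\<lambda>a. \<phi> a (shrink_proj S a x)) \<longlongrightarrow> g (card S)) (at_right 0)"
  shows "((\<lambda>a. LINT v|sphere_unif. mix_density a \<delta> v * \<phi> a v) \<longlongrightarrow> 
      (\<Sum>k=1..CARD('n). g k * K_prob CARD('n) \<delta> k)) (at_right 0)"
proof -
  define \<kappa> where "\<kappa> = 2 / (measure lborel (cball (0 :: real^'n) 1) * sqrt (real CARD('n)) ^ CARD('n))"
  define B where "B = (\<Sum>k=1..CARD('n). K_weight CARD('n) \<delta> k)"
  have \<kappa>B: "\<kappa> * B > 0"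
    unfolding \<kappa>_def B_def by (rule mix_mass_limit_pos[OF \<delta>])
  have "((\<lambda>a. (LINT v|sphere_unif. mix_prod a \<delta> v * \<phi> a v) / (LINT v|sphere_unif. mix_prod a \<delta> (v :: real^'n))) \<longlongrightarrow>
     (\<kappa> * (\<Sum>k=1..CARD('n). g k * K_weight CARD('n) \<delta> k)) / (\<kappa> * B)) (at_right 0)"
    using \<kappa>B unfolding \<kappa>_def B_def
    by (intro tendsto_divide mix_prod_integral_tendsto[OF \<delta>, where C=C] mix_prod_mass_tendsto \<delta> bound lim meas) auto
  also have "(\<kappa> * (\<Sum>k=1..CARD('n). g k * K_weight CARD('n) \<delta> k)) / (\<kappa> * B) = (\<Sum>k=1..CARD('n). g k * K_prob CARD('n) \<delta> k)"
    using \<kappa>B unfolding K_prob_def B_def[symmetric] by (auto simp: sum_divide_distrib)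
  finally show ?thesis
    by (simp add: mix_density_def)
qed

section \<open>Rotations and dissipation\<close>

lemma shrink_proj_nth:
  "shrink_proj S a (x :: real^'n) $ i =
     sqrt (real CARD('n)) / norm (shrink S a x) * (if i \<in> S then x $ i else sqrt a * x $ i)"
  by (simp add: shrink_proj_def sgn_div_norm divide_inverse) (simp add: shrink_def)

lemma shrink_proj_nth_tendsto:
  assumes "sqsum S x > 0"
  shows "((\<lambda>a. shrink_proj S a (x :: real^'n) $ i) \<longlongrightarrow>
    sqrt (real CARD('n)) / sqrt (sqsum S x) * (if i \<in> S then x $ i else 0)) (at_right 0)"
proof -
  have "((\<lambda>a::real. sqrt a * x $ i) \<longlongrightarrow> sqrt 0 * x $ i) (at_right 0)"
    by (intro tendsto_intros)
  then have "((\<lambda>a. if i \<in> S then x $ i else sqrt a * x $ i) \<longlongrightarrow> (if i \<in> S then x $ i else 0)) (at_right 0)"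
    by auto
  then show ?thesis
    unfolding shrink_proj_nth using assms
    by (intro tendsto_mult tendsto_divide tendsto_const norm_shrink_tendsto) auto
qed

lemma shrink_proj_nth_div_sqrt_tendsto:
  assumes "sqsum S x > 0" "i \<notin> S"
  shows "((\<lambda>a. shrink_proj S a (x :: real^'n) $ i / sqrt a) \<longlongrightarrow>
    sqrt (real CARD('n)) / sqrt (sqsum S x) * x $ i) (at_right 0)"
proof -
  have "((\<lambda>a. sqrt (real CARD('n)) / norm (shrink S a x) * x $ i) \<longlongrightarrow>
      sqrt (real CARD('n)) / sqrt (sqsum S x) * x $ i) (at_right 0)"
    using assms by (intro tendsto_mult tendsto_divide tendsto_const norm_shrink_tendsto) auto
  moreover have "\<forall>\<^sub>F a in at_right 0. sqrt (real CARD('n)) / norm (shrink S a x) * x $ i = shrink_proj S a x $ i / sqrt a"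
    using eventually_at_right_0_less[OF zero_less_one]
    by eventually_elim (use assms in \<open>simp add: shrink_proj_nth\<close>)
  ultimately show ?thesis
    by (rule Lim_transform_eventually)
qed

lemma kac_sphere_nth_le:
  fixes v :: "real^'n"
  assumes "v \<in> kac_sphere"
  shows "(v $ i)\<^sup>2 \<le> real CARD('n)"
proof -
  have "(v $ i)\<^sup>2 \<le> (\<Sum>i\<in>UNIV. (v $ i)\<^sup>2)"
    by (intro member_le_sum) auto
  then show ?thesis using assms by (simp add: kac_sphere_def)
qed

lemma plane_rot_nth:
  "plane_rot i j \<theta> v $ k = (if k = i then v $ i * cos \<theta> - v $ j * sin \<theta>
     else if k = j then v $ i * sin \<theta> + v $ j * cos \<theta> else v $ k)"
  by (simp add: plane_rot_def)

text \<open>Stated for any h because it serves twice: with squares it shows that rotations preserve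
  the norm, with \<open>mix_log\<close> it gives the increment of the logarithm.\<close>

lemma sum_plane_rot:
  fixes h :: "real \<Rightarrow> real" and v :: "real^'n"
  assumes "i \<noteq> j"
  shows "(\<Sum>k\<in>UNIV. h (v $ k)) - (\<Sum>k\<in>UNIV. h (plane_rot i j \<theta> v $ k)) =
    h (v $ i) + h (v $ j) - h (v $ i * cos \<theta> - v $ j * sin \<theta>) - h (v $ i * sin \<theta> + v $ j * cos \<theta>)"
proof -
  have "(\<Sum>k\<in>UNIV. h (v $ k)) - (\<Sum>k\<in>UNIV. h (plane_rot i j \<theta> v $ k)) =
      (\<Sum>k\<in>UNIV. h (v $ k) - h (plane_rot i j \<theta> v $ k))"
    by (simp add: sum_subtractf)
  also have "\<dots> = (\<Sum>k\<in>{i, j}. h (v $ k) - h (plane_rot i j \<theta> v $ k))"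
    by (intro sum.mono_neutral_right) (auto simp: plane_rot_nth)
  finally show ?thesis using assms by (simp add: plane_rot_nth)
qed

lemma norm_plane_rot:
  assumes "i \<noteq> j"
  shows "norm (plane_rot i j \<theta> v) = norm (v :: real^'n)"
proof -
  have "sqsum UNIV v - sqsum UNIV (plane_rot i j \<theta> v) = (v $ i)\<^sup>2 + (v $ j)\<^sup>2 - 
     (v $ i * cos \<theta> - v $ j * sin \<theta>)\<^sup>2 - (v $ i * sin \<theta> + v $ j * cos \<theta>)\<^sup>2"
    unfolding sqsum_def by (rule sum_plane_rot) fact
  also have "\<dots> = ((v $ i)\<^sup>2 + (v $ j)\<^sup>2) * (1 - ((sin \<theta>)\<^sup>2 + (cos \<theta>)\<^sup>2))"
  proof -
    have "p\<^sup>2 + q\<^sup>2 - (p * c - q * s)\<^sup>2 - (p * s + q * c)\<^sup>2 = (p\<^sup>2 + q\<^sup>2) * (1 - (s\<^sup>2 + c\<^sup>2))" for p q c s :: real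
      by (simp add: power2_eq_square algebra_simps)
    then show ?thesis .
  qed
  finally have "(norm v)\<^sup>2 = (norm (plane_rot i j \<theta> v))\<^sup>2"
    by (simp add: sqsum_UNIV)
  then show ?thesis by simp
qed

lemma plane_rot_kac_sphere: "i \<noteq> j \<Longrightarrow> plane_rot i j \<theta> v \<in> kac_sphere \<longleftrightarrow> v \<in> kac_sphere"
  by (simp add: norm_kac_sphere norm_plane_rot)

lemma orthogonal_plane_rot:
  assumes "i \<noteq> j"
  shows "orthogonal_transformation (plane_rot i j \<theta> :: real^'n \<Rightarrow> _)"
  unfolding orthogonal_transformation
proof (intro conjI allI)
  show "linear (plane_rot i j \<theta> :: real^'n \<Rightarrow> _)"
    by (rule linearI) (auto simp: vec_eq_iff plane_rot_nth algebra_simps)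
qed (simp add: norm_plane_rot[OF assms])

lemma plane_rot_minus:
  assumes "i \<noteq> j"
  shows "plane_rot i j (- \<theta>) (plane_rot i j \<theta> v) = v"
proof -
  have 1: "(cos \<theta>)\<^sup>2 + (sin \<theta>)\<^sup>2 = 1" by simp
  have "(p * c - q * s) * c + (p * s + q * c) * s = p * (c\<^sup>2 + s\<^sup>2)"
    "(p * s + q * c) * c - (p * c - q * s) * s = q * (c\<^sup>2 + s\<^sup>2)" for p q c s :: real
    by (simp_all add: power2_eq_square algebra_simps)
  from this[where c = "cos \<theta>" and s = "sin \<theta>", unfolded 1] show ?thesis
    using assms by (auto simp: vec_eq_iff plane_rot_nth)
qed

text \<open>Angle and vector vary together here, which yields the joint measurability behind
  Fubini.\<close>

lemma measurable_plane_rot [measurable (raw)]: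
  assumes [measurable]: "f \<in> borel_measurable M" "g \<in> borel_measurable M"
  shows "(\<lambda>x. plane_rot i j (g x) (f x :: real^'n)) \<in> borel_measurable M"
proof (rule borel_measurable_euclidean_space[THEN iffD2], rule ballI)
  fix b :: "real^'n" assume "b \<in> Basis"
  then obtain k where b: "b = axis k 1" by (auto simp: Basis_vec_real)
  have [measurable]: "(\<lambda>x. f x $ k) \<in> borel_measurable M" for k
    by (rule measurable_compose[OF assms(1) measurable_vec_nth_borel])
  show "(\<lambda>x. plane_rot i j (g x) (f x) \<bullet> b) \<in> borel_measurable M"
    by (simp add: b inner_axis plane_rot_nth)
qed

lemma integral_sphere_plane_rot:
  fixes f :: "real^'n::{finite,wellorder} \<Rightarrow> real"
  assumes "i \<noteq> j" and [measurable]: "f \<in> borel_measurable borel"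
  shows "(LINT v|sphere_unif. f (plane_rot i j \<theta> v)) = (LINT v|sphere_unif. f v)"
proof -
  have "(LINT v|sphere_unif. f v) = (LINT v|distr sphere_unif borel (plane_rot i j \<theta>). f v)"
    using sphere_unif_orthogonal[OF orthogonal_plane_rot[OF assms(1), of \<theta>]] by simp
  also have "\<dots> = (LINT v|sphere_unif. f (plane_rot i j \<theta> v))"
    by (rule integral_distr) measurable
  finally show ?thesis ..
qed

lemma abs_mult_diff_le:
  fixes x y z B :: real
  assumes "\<bar>x\<bar> \<le> A" "\<bar>y\<bar> \<le> B" "\<bar>z\<bar> \<le> B"
  shows "\<bar>x * (y - z)\<bar> \<le> A * (2 * B)"
  unfolding abs_mult using assms by (intro mult_mono) auto

text \<open>Invariance of the sphere measure moves the gain term back to \<open>F v\<close>, at the price of the inverse rotation.\<close>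
lemma kac_pair_symmetrize:
  fixes F G :: "real^'n::{finite,wellorder} \<Rightarrow> real"
  assumes ij: "i \<noteq> j" and [measurable]: "F \<in> borel_measurable borel" "G \<in> borel_measurable borel"
    and F: "\<And>v. v \<in> kac_sphere \<Longrightarrow> \<bar>F v\<bar> \<le> A" and G: "\<And>v. v \<in> kac_sphere \<Longrightarrow> \<bar>G v\<bar> \<le> B"
  defines "J \<equiv> \<lambda>\<theta>. LINT v|sphere_unif. F v * (G v - G (plane_rot i j \<theta> v))"
  shows "(LINT v|sphere_unif. (LINT \<theta>:{0..2*pi}|lborel.
      (F v - F (plane_rot i j \<theta> v)) * (G v - G (plane_rot i j \<theta> v)) / (2 * pi))) =
    (LINT \<theta>|lborel. indicator {0..2*pi} \<theta> * ((J \<theta> + J (- \<theta>)) / (2 * pi)))"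
proof -
  interpret S: prob_space "sphere_unif :: (real^'n::_) measure"
    by (rule prob_space_sphere_unif)
  interpret P: pair_sigma_finite "sphere_unif :: (real^'n::_) measure" "lborel :: real measure" ..
  define h where "h v \<theta> = indicator {0..2*pi} \<theta> * 
     ((F v - F (plane_rot i j \<theta> v)) * (G v - G (plane_rot i j \<theta> v)) / (2 * pi))" for v \<theta>
  have [measurable]: "(\<lambda>p. h (fst p) (snd p)) \<in> borel_measurable (sphere_unif \<Otimes>\<^sub>M lborel)"
    unfolding h_def by measurable
  then have hm [measurable]: "case_prod h \<in> borel_measurable (sphere_unif \<Otimes>\<^sub>M lborel)"
    by (simp add: case_prod_beta')
  define C where "C = 2 * A * (2 * B) / (2 * pi)"
  have hb: "\<bar>h v \<theta>\<bar> \<le> C * indicator {0..2*pi} \<theta>" if "v \<in> kac_sphere" for v \<theta>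
  proof -
    have R: "plane_rot i j \<theta> v \<in> kac_sphere" using that ij by (simp add: plane_rot_kac_sphere)
    have "\<bar>F v - F (plane_rot i j \<theta> v)\<bar> \<le> 2 * A"
      using F[OF that] F[OF R] by linarith
    then have "\<bar>(F v - F (plane_rot i j \<theta> v)) * (G v - G (plane_rot i j \<theta> v))\<bar> \<le> 2 * A * (2 * B)"
      by (rule abs_mult_diff_le) (use G that R in auto)
    then have "\<bar>(F v - F (plane_rot i j \<theta> v)) * (G v - G (plane_rot i j \<theta> v)) / (2 * pi)\<bar> \<le> C"
      unfolding C_def abs_divide by (simp only: abs_of_pos[of "2 * pi"] pi_gt_zero divide_right_mono mult_pos_pos zero_less_numeral pi_ge_zero mult_nonneg_nonneg zero_le_numeral)
    then show ?thesis
      by (simp add: h_def indicator_def)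
  qed
  have ind: "integrable lborel (\<lambda>\<theta>. C * indicator {0..2*pi} \<theta> :: real)"
    by (intro integrable_mult_right) simp
  have int: "integrable (sphere_unif \<Otimes>\<^sub>M lborel) (case_prod h)"
  proof (rule P.Fubini_integrable)
    have hi: "integrable lborel (\<lambda>\<theta>. h v \<theta>)" if "v \<in> kac_sphere" for v
      by (rule Bochner_Integration.integrable_bound[OF ind]) 
         (use hb[OF that] in \<open>auto intro: order_trans[OF _ abs_ge_self]\<close>)
    show "AE v in sphere_unif. integrable lborel (\<lambda>\<theta>. case (v, \<theta>) of (v, \<theta>) \<Rightarrow> h v \<theta>)"
      using AE_sphere_unif by eventually_elim (simp add: hi)
    show "integrable sphere_unif (\<lambda>v. LINT \<theta>|lborel. norm (case (v, \<theta>) of (v, \<theta>) \<Rightarrow> h v \<theta>))"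
    proof (rule integrable_sphere_bounded)
      fix v :: "real^'n::_" assume v: "v \<in> kac_sphere"
      have "(LINT \<theta>|lborel. norm (h v \<theta>)) \<le> (LINT \<theta>|lborel. C * indicator {0..2*pi} \<theta>)"
        using hb[OF v] by (intro integral_mono integrable_norm hi v ind) auto
      then show "\<bar>LINT \<theta>|lborel. norm (case (v, \<theta>) of (v, \<theta>) \<Rightarrow> h v \<theta>)\<bar> \<le> (LINT \<theta>|lborel. C * indicator {0..2*pi} \<theta>)"
        by simp
    qed measurable
  qed measurable
  have "(LINT v|sphere_unif. (LINT \<theta>:{0..2*pi}|lborel.
      (F v - F (plane_rot i j \<theta> v)) * (G v - G (plane_rot i j \<theta> v)) / (2 * pi))) = 
      (LINT v|sphere_unif. (LINT \<theta>|lborel. h v \<theta>))"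
    by (simp add: set_lebesgue_integral_def h_def)
  also have "\<dots> = (LINT \<theta>|lborel. (LINT v|sphere_unif. h v \<theta>))"
    by (rule P.Fubini_integral[OF int, symmetric])
  also have "\<dots> = (LINT \<theta>|lborel. indicator {0..2*pi} \<theta> * ((J \<theta> + J (- \<theta>)) / (2 * pi)))"
  proof (intro Bochner_Integration.integral_cong refl)
    fix \<theta> :: real
    let ?R = "plane_rot i j \<theta>" and ?R' = "plane_rot i j (- \<theta>)"
    have i1: "integrable sphere_unif (\<lambda>v. F v * (G v - G (plane_rot i j \<phi> v)))" for \<phi>
      by (rule integrable_sphere_bounded[where C="A * (2 * B)"])
         (use F G plane_rot_kac_sphere[OF ij] in \<open>auto intro!: abs_mult_diff_le\<close>)
    have i2: "integrable sphere_unif (\<lambda>v. F (?R v) * (G (?R v) - G v))"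
      by (rule integrable_sphere_bounded[where C="A * (2 * B)"])
         (use F G plane_rot_kac_sphere[OF ij] in \<open>auto intro!: abs_mult_diff_le\<close>)
    \<comment> \<open>Substituting the rotated point for v undoes the opposite rotation inside G;
      the two integrands then add up to the product of differences.\<close>
    have "J (- \<theta>) = (LINT v|sphere_unif. F (?R v) * (G (?R v) - G (?R' (?R v))))"
      unfolding J_def by (rule integral_sphere_plane_rot[OF ij, symmetric]) measurable
    also have "\<dots> = (LINT v|sphere_unif. F (?R v) * (G (?R v) - G v))"
      by (simp add: plane_rot_minus[OF ij])
    finally have "J \<theta> + J (- \<theta>) = (LINT v|sphere_unif. F v * (G v - G (?R v)) + F (?R v) * (G (?R v) - G v))"
      unfolding J_def using i1 i2 by (subst Bochner_Integration.integral_add) auto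
    also have "\<dots> = (LINT v|sphere_unif. (F v - F (?R v)) * (G v - G (?R v)))"
      by (intro Bochner_Integration.integral_cong refl) (simp add: algebra_simps)
    finally show "(LINT v|sphere_unif. h v \<theta>) = indicator {0..2*pi} \<theta> * ((J \<theta> + J (- \<theta>)) / (2 * pi))"
      by (simp add: h_def)
  qed
  finally show ?thesis .
qed

section \<open>Increments of the logarithm under a rotation\<close>

definition mix_log_sum :: "real \<Rightarrow> real \<Rightarrow> real^'n \<Rightarrow> real" where
  "mix_log_sum a \<delta> v = (\<Sum>i\<in>UNIV. mix_log a \<delta> (v $ i))"

lemma measurable_mix_log_sum [measurable]: "(mix_log_sum a \<delta> :: real^'n \<Rightarrow> real) \<in> borel_measurable borel"
  unfolding mix_log_sum_def by measurable

lemma measurable_mix_density [measurable]: "(mix_density a \<delta> :: real^'n \<Rightarrow> real) \<in> borel_measurable borel"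
  unfolding mix_density_def by measurable

context
  fixes \<delta> :: real
  assumes \<delta>: "0 < \<delta>" "\<delta> < 1"
begin

lemma ln_mix_density:
  assumes "0 < a" "a < 1"
  shows "ln (mix_density a \<delta> (v :: real^'n)) = 
    ln (1 / a) * mix_log_sum a \<delta> v - ln (LINT w|(sphere_unif :: (real^'n) measure). mix_prod a \<delta> w)"
proof -
  have "mix_density a \<delta> v > 0" by (rule mix_density_prob) (use \<delta> assms in auto)
  then have Z: "(LINT w|(sphere_unif :: (real^'n) measure). mix_prod a \<delta> w) > 0"
    using mix_prod_pos[OF assms(1) \<delta>, of v] by (simp add: mix_density_def zero_less_divide_iff)
  have "ln (mix_prod a \<delta> v) = (\<Sum>i\<in>UNIV. ln (gauss_mix a \<delta> (v $ i)))"
    unfolding mix_prod_def by (intro ln_prod) (auto simp: less_imp_neq[OF gauss_mix_pos[OF \<delta> assms(1)], symmetric])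
  also have "\<dots> = ln (1 / a) * mix_log_sum a \<delta> v"
    using assms by (simp add: mix_log_sum_def mix_log_def sum_distrib_left)
  finally show ?thesis
    using Z mix_prod_pos[OF assms(1) \<delta>, of v] by (simp add: mix_density_def ln_div)
qed

text \<open>The bound depends on a and serves only for integrability at fixed a.\<close>

lemma mix_density_bounded:
  assumes "0 < a" "a < 1"
  shows "\<exists>A. \<forall>v :: real^'n. \<bar>mix_density a \<delta> v\<bar> \<le> A"
proof -
  define Z where "Z = (LINT w|(sphere_unif :: (real^'n) measure). mix_prod a \<delta> w)"
  have "\<bar>mix_density a \<delta> v\<bar> \<le> (1 / sqrt a) ^ CARD('n) / \<bar>Z\<bar>" for v :: "real^'n"
  proof -
    have "mix_prod a \<delta> v \<le> (\<Prod>i\<in>(UNIV::'n set). 1 / sqrt a)"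
      unfolding mix_prod_def using gauss_mix_le[OF \<delta> assms] gauss_mix_pos[OF \<delta> assms(1)]
      by (intro prod_mono) (auto simp: less_imp_le)
    then show ?thesis
      using mix_prod_pos[OF assms(1) \<delta>, of v] 
      by (auto simp: mix_density_def Z_def[symmetric] abs_divide intro!: divide_right_mono)
  qed
  then show ?thesis by blast
qed

lemma mix_log_sum_bounded:
  "\<exists>C. \<forall>\<^sub>F a in at_right 0. \<forall>v\<in>kac_sphere. \<bar>mix_log_sum a \<delta> (v :: real^'n)\<bar> \<le> C"
proof -
  obtain C where C: "\<forall>\<^sub>F a in at_right 0. \<forall>x. x\<^sup>2 \<le> real CARD('n) \<longrightarrow> \<bar>mix_log a \<delta> x\<bar> \<le> C"
    using mix_log_bounded[OF \<delta>] by blast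
  then have "\<forall>\<^sub>F a in at_right 0. \<forall>v\<in>kac_sphere. \<bar>mix_log_sum a \<delta> (v :: real^'n)\<bar> \<le> real CARD('n) * C"
  proof eventually_elim
    case (elim a)
    show ?case
    proof
      fix v :: "real^'n" assume v: "v \<in> kac_sphere"
      have "\<bar>mix_log_sum a \<delta> v\<bar> \<le> (\<Sum>i\<in>(UNIV::'n set). C)"
        unfolding mix_log_sum_def using elim kac_sphere_nth_le[OF v]
        by (intro order_trans[OF sum_abs] sum_mono) auto
      then show "\<bar>mix_log_sum a \<delta> v\<bar> \<le> real CARD('n) * C" by simp
    qed
  qed
  then show ?thesis by blast
qed

lemma mix_log_nth_tendsto:
  assumes S: "S \<noteq> {}"
  shows "AE x :: real^'n in lborel. 
    ((\<lambda>a. mix_log a \<delta> (shrink_proj S a x $ i)) \<longlongrightarrow> (if i \<in> S then 0 else 1 / 2)) (at_right 0)"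
  using AE_sqsum_pos[OF S] AE_vec_nth_nonzero[of i]
proof eventually_elim
  case (elim x)
  show ?case
  proof (cases "i \<in> S")
    case True
    have "\<forall>\<^sub>F a in at_right 0. (shrink_proj S a x $ i)\<^sup>2 \<le> real CARD('n)"
      using eventually_at_right_0_less[OF zero_less_one]
      by eventually_elim (use elim in \<open>auto intro!: kac_sphere_nth_le shrink_proj_in_kac_sphere\<close>)
    then show ?thesis
      using True elim by (auto intro!: mix_log_tendsto_0[OF \<delta> shrink_proj_nth_tendsto])
  next
    case False
    then show ?thesis
      using elim by (auto intro!: mix_log_tendsto_half[OF \<delta> shrink_proj_nth_div_sqrt_tendsto])
  qed
qed

text \<open>If one index lies in S, its nonzero coefficient keeps the limit away from 0; if both do,
  x avoids a hyperplane. If neither does, the combination is again of order sqrt a. The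
  normalisation of c and d keeps the square at most N.\<close>

lemma mix_log_lincomb_tendsto:
  assumes S: "S \<noteq> {}" and ij: "i \<noteq> j" and cd: "c \<noteq> 0" "d \<noteq> 0" "c\<^sup>2 + d\<^sup>2 = 1"
  shows "AE x :: real^'n in lborel. 
    ((\<lambda>a. mix_log a \<delta> (c * shrink_proj S a x $ i + d * shrink_proj S a x $ j)) \<longlongrightarrow> 
       (if i \<in> S \<or> j \<in> S then 0 else 1 / 2)) (at_right 0)"
  using AE_sqsum_pos[OF S] AE_vec_nth_nonzero[of i] AE_vec_nth_nonzero[of j] 
     AE_lincomb_nonzero[OF ij disjI1[OF cd(1)], of d]
proof eventually_elim
  case (elim x)
  let ?r = "sqrt (real CARD('n)) / sqrt (sqsum S x)"
  show ?case
  proof (cases "i \<in> S \<or> j \<in> S")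
    case True
    have "\<forall>\<^sub>F a in at_right 0. (c * shrink_proj S a x $ i + d * shrink_proj S a x $ j)\<^sup>2 \<le> real CARD('n)"
      using eventually_at_right_0_less[OF zero_less_one]
    proof eventually_elim
      case (elim a)
      define p where "p = shrink_proj S a x $ i"
      define q where "q = shrink_proj S a x $ j"
      \<comment> \<open>The added square completes the Lagrange identity for two terms.\<close>
      have "(c * p + d * q)\<^sup>2 \<le> (c * p + d * q)\<^sup>2 + (d * p - c * q)\<^sup>2" by simp
      also have "\<dots> = (c\<^sup>2 + d\<^sup>2) * (p\<^sup>2 + q\<^sup>2)" by (simp add: power2_eq_square algebra_simps)
      also have "\<dots> = (\<Sum>k\<in>{i, j}. (shrink_proj S a x $ k)\<^sup>2)" using cd ij by (simp add: p_def q_def)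
      also have "\<dots> \<le> (\<Sum>k\<in>UNIV. (shrink_proj S a x $ k)\<^sup>2)" by (intro sum_mono2) auto
      also have "\<dots> = real CARD('n)"
      proof -
        have "x \<noteq> 0" using \<open>x $ i \<noteq> 0\<close> by auto
        then show ?thesis
          using shrink_proj_in_kac_sphere[of a x S] elim by (simp add: kac_sphere_def)
      qed
      finally show ?case by (simp add: p_def q_def)
    qed
    moreover have "((\<lambda>a. c * shrink_proj S a x $ i + d * shrink_proj S a x $ j) \<longlongrightarrow> 
        c * (?r * (if i \<in> S then x $ i else 0)) + d * (?r * (if j \<in> S then x $ j else 0))) (at_right 0)"
      using elim by (intro tendsto_intros shrink_proj_nth_tendsto)
    moreover have "c * (?r * (if i \<in> S then x $ i else 0)) + d * (?r * (if j \<in> S then x $ j else 0)) \<noteq> 0"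
    proof -
      have "c * (?r * (if i \<in> S then x $ i else 0)) + d * (?r * (if j \<in> S then x $ j else 0)) =
        ?r * (c * (if i \<in> S then x $ i else 0) + d * (if j \<in> S then x $ j else 0))"
        by (simp add: algebra_simps)
      then show ?thesis
        using elim True cd by auto
    qed
    ultimately show ?thesis
      using True by (auto intro!: mix_log_tendsto_0[OF \<delta>])
  next
    case False
    then have "((\<lambda>a. c * (shrink_proj S a x $ i / sqrt a) + d * (shrink_proj S a x $ j / sqrt a)) \<longlongrightarrow>
       c * (?r * x $ i) + d * (?r * x $ j)) (at_right 0)"
      using elim by (intro tendsto_intros shrink_proj_nth_div_sqrt_tendsto) auto
    then show ?thesis
      using False by (auto intro!: mix_log_tendsto_half[OF \<delta>] simp: add_divide_distrib)
  qed
qed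

text \<open>A separated pair has one small coordinate before the rotation and none after it, a loss
  of 1/2; otherwise the number of small ones is unchanged. When the sine or the cosine vanishes, the
  rotation merely permutes the two coordinates up to sign and nothing is lost.\<close>

lemma mix_log_sum_diff_tendsto:
  assumes S: "S \<noteq> {}" and ij: "i \<noteq> j" and \<theta>: "sin \<theta> \<noteq> 0" "cos \<theta> \<noteq> 0"
  shows "AE x :: real^'n in lborel.
    ((\<lambda>a. mix_log_sum a \<delta> (shrink_proj S a x) - mix_log_sum a \<delta> (plane_rot i j \<theta> (shrink_proj S a x))) \<longlongrightarrow> 
       (if (i \<in> S) \<noteq> (j \<in> S) then 1 / 2 else 0)) (at_right 0)"
proof -
  have 1: "AE x :: real^'n in lborel. 
    ((\<lambda>a. mix_log a \<delta> (cos \<theta> * shrink_proj S a x $ i + (- sin \<theta>) * shrink_proj S a x $ j)) \<longlongrightarrow> 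
       (if i \<in> S \<or> j \<in> S then 0 else 1 / 2)) (at_right 0)"
    by (rule mix_log_lincomb_tendsto) (use S ij \<theta> in auto)
  have 2: "AE x :: real^'n in lborel. 
    ((\<lambda>a. mix_log a \<delta> (sin \<theta> * shrink_proj S a x $ i + cos \<theta> * shrink_proj S a x $ j)) \<longlongrightarrow> 
       (if i \<in> S \<or> j \<in> S then 0 else 1 / 2)) (at_right 0)"
    by (rule mix_log_lincomb_tendsto) (use S ij \<theta> in auto)
  show ?thesis
    using mix_log_nth_tendsto[OF S, of i] mix_log_nth_tendsto[OF S, of j] 1 2
  proof eventually_elim
    case (elim x)
    have "((\<lambda>a. mix_log a \<delta> (shrink_proj S a x $ i) + mix_log a \<delta> (shrink_proj S a x $ j)
        - mix_log a \<delta> (cos \<theta> * shrink_proj S a x $ i + (- sin \<theta>) * shrink_proj S a x $ j)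
        - mix_log a \<delta> (sin \<theta> * shrink_proj S a x $ i + cos \<theta> * shrink_proj S a x $ j)) \<longlongrightarrow>
       (if i \<in> S then 0 else 1 / 2) + (if j \<in> S then 0 else 1 / 2) - (if i \<in> S \<or> j \<in> S then 0 else 1 / 2)
         - (if i \<in> S \<or> j \<in> S then 0 else 1 / 2)) (at_right 0)"
      by (intro tendsto_intros elim)
    moreover have "(if i \<in> S then 0 else 1 / 2) + (if j \<in> S then 0 else 1 / 2) - (if i \<in> S \<or> j \<in> S then 0 else 1 / 2)
         - (if i \<in> S \<or> j \<in> S then 0 else 1 / 2) = (if (i \<in> S) \<noteq> (j \<in> S) then 1 / 2 else (0 :: real))"
      by auto
    ultimately show ?case
      unfolding mix_log_sum_def sum_plane_rot[OF ij] by (simp add: mult.commute)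
  qed
qed

end

text \<open>A separated pair is reordered with its member of S first; sorting by \<open>min\<close>
  and \<open>max\<close> inverts this.\<close>

lemma card_separated_pairs:
  fixes S :: "'n::{finite,linorder} set"
  shows "card {(i, j). i < j \<and> (i \<in> S) \<noteq> (j \<in> S)} = card S * (CARD('n) - card S)"
proof -
  have "bij_betw (\<lambda>(i, j). if i \<in> S then (i, j) else (j, i)) {(i, j). i < j \<and> (i \<in> S) \<noteq> (j \<in> S)} (S \<times> - S)"
    by (rule bij_betw_byWitness[where f' = "\<lambda>(s, t). (min s t, max s t)"])
       (auto simp: min_def max_def not_le order_less_le split: if_splits)
  from bij_betw_same_card[OF this] show ?thesis
    by (simp add: card_cartesian_product card_Diff_subset Compl_eq_Diff_UNIV)
qed

section \<open>The limit of the entropy\<close>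

context
  fixes \<delta> :: real
  assumes \<delta>: "0 < \<delta>" "\<delta> < 1"
begin

lemma mix_log_sum_integral_tendsto:
  "((\<lambda>a. LINT v|sphere_unif. mix_density a \<delta> v * mix_log_sum a \<delta> (v :: real^'n)) \<longlongrightarrow>
     (\<Sum>k=1..CARD('n). (real CARD('n) - real k) / 2 * K_prob CARD('n) \<delta> k)) (at_right 0)"
proof -
  obtain C where C: "\<forall>\<^sub>F a in at_right 0. \<forall>v\<in>kac_sphere. \<bar>mix_log_sum a \<delta> (v :: real^'n)\<bar> \<le> C"
    using mix_log_sum_bounded[OF \<delta>] by blast
  show ?thesis
  proof (rule mix_density_integral_tendsto[OF \<delta> _ C])
    fix S :: "'n set" assume S: "S \<noteq> {}"
    have lim: "AE x :: real^'n in lborel. \<forall>i\<in>UNIV. 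
      ((\<lambda>a. mix_log a \<delta> (shrink_proj S a x $ i)) \<longlongrightarrow> (if i \<in> S then 0 else 1 / 2)) (at_right 0)"
      by (intro AE_finite_allI mix_log_nth_tendsto[OF \<delta> S]) simp
    have e: "(\<Sum>i\<in>UNIV. if i \<in> S then 0 else 1 / 2) = (real CARD('n) - real (card S)) / 2"
    proof -
      have "(\<Sum>i\<in>UNIV. if i \<in> S then 0 else 1 / 2 :: real) = (\<Sum>i\<in>-S. 1 / 2)"
        by (intro sum.mono_neutral_cong_right) auto
      also have "\<dots> = real (card (-S)) / 2" by simp
      also have "card (-S) = CARD('n) - card S"
        by (simp add: card_Diff_subset Compl_eq_Diff_UNIV)
      finally show ?thesis by (simp add: of_nat_diff card_mono)
    qed
    show "AE x :: real^'n in lborel. ((\<lambda>a. mix_log_sum a \<delta> (shrink_proj S a x)) \<longlongrightarrow> 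
        (real CARD('n) - real (card S)) / 2) (at_right 0)"
      unfolding mix_log_sum_def e[symmetric] using lim by eventually_elim (intro tendsto_sum, blast)
  qed measurable
qed

text \<open>ln Z(a) has a finite limit because Z(a) has a positive one, so division by ln (1/a)
  removes it and only the average of \<open>mix_log_sum\<close> remains.\<close>

lemma sphere_entropy_tendsto:
  "((\<lambda>a. sphere_entropy (mix_density a \<delta> :: real^'n \<Rightarrow> real) / ln (1 / a)) \<longlongrightarrow>
     (\<Sum>k=1..CARD('n). (real CARD('n) - real k) / 2 * K_prob CARD('n) \<delta> k)) (at_right 0)"
proof -
  define Z where "Z a = (LINT w|(sphere_unif :: (real^'n) measure). mix_prod a \<delta> w)" for a
  define Z0 where "Z0 = 2 / (measure lborel (cball (0 :: real^'n) 1) * sqrt (real CARD('n)) ^ CARD('n)) *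
       (\<Sum>k=1..CARD('n). K_weight CARD('n) \<delta> k)"
  have "(Z \<longlongrightarrow> Z0) (at_right 0)"
    unfolding Z_def Z0_def by (rule mix_prod_mass_tendsto[OF \<delta>])
  moreover have "Z0 > 0"
    unfolding Z0_def by (rule mix_mass_limit_pos[OF \<delta>])
  ultimately have "((\<lambda>a. ln (Z a)) \<longlongrightarrow> ln Z0) (at_right 0)"
    by (intro tendsto_ln) auto
  then have "((\<lambda>a. ln (Z a) / ln (1 / a)) \<longlongrightarrow> 0) (at_right 0)"
    by (rule real_tendsto_divide_at_top[OF _ ln_inverse_at_top])
  from tendsto_diff[OF mix_log_sum_integral_tendsto this]
  have "((\<lambda>a. (LINT v|sphere_unif. mix_density a \<delta> v * mix_log_sum a \<delta> (v :: real^'n)) - ln (Z a) / ln (1 / a)) \<longlongrightarrow>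
     (\<Sum>k=1..CARD('n). (real CARD('n) - real k) / 2 * K_prob CARD('n) \<delta> k)) (at_right 0)"
    by simp
  moreover obtain C where C: "\<forall>\<^sub>F a in at_right 0. \<forall>v\<in>kac_sphere. \<bar>mix_log_sum a \<delta> (v :: real^'n)\<bar> \<le> C"
    using mix_log_sum_bounded[OF \<delta>] by blast
  have "\<forall>\<^sub>F a in at_right 0. (LINT v|sphere_unif. mix_density a \<delta> v * mix_log_sum a \<delta> (v :: real^'n)) - ln (Z a) / ln (1 / a) =
      sphere_entropy (mix_density a \<delta> :: real^'n \<Rightarrow> real) / ln (1 / a)"
    using C eventually_at_right_0_less[OF zero_less_one]
  proof eventually_elim
    case (elim a)
    then have a: "0 < a" "a < 1" by auto
    obtain A where A: "\<And>v :: real^'n. \<bar>mix_density a \<delta> v\<bar> \<le> A"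
      using mix_density_bounded[OF \<delta> a] by blast
    have i1: "integrable sphere_unif (mix_density a \<delta> :: real^'n \<Rightarrow> real)"
      by (rule integrable_sphere_bounded[where C=A]) (use A in auto)
    have i2: "integrable sphere_unif (\<lambda>v :: real^'n. mix_density a \<delta> v * mix_log_sum a \<delta> v)"
    proof (rule integrable_sphere_bounded)
      fix v :: "real^'n" assume "v \<in> kac_sphere"
      then show "\<bar>mix_density a \<delta> v * mix_log_sum a \<delta> v\<bar> \<le> A * C"
        unfolding abs_mult using A[of v] elim by (intro mult_mono) auto
    qed measurable
    have "sphere_entropy (mix_density a \<delta> :: real^'n \<Rightarrow> real) = 
       (LINT v|sphere_unif. ln (1 / a) * (mix_density a \<delta> v * mix_log_sum a \<delta> (v :: real^'n)) - ln (Z a) * mix_density a \<delta> v)"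
      unfolding sphere_entropy_def ln_mix_density[OF \<delta> a] Z_def by (simp add: algebra_simps)
    also have "\<dots> = ln (1 / a) * (LINT v|sphere_unif. mix_density a \<delta> v * mix_log_sum a \<delta> (v :: real^'n)) - 
        ln (Z a) * (LINT v|sphere_unif. mix_density a \<delta> (v :: real^'n))"
      using i1 i2 by (subst Bochner_Integration.integral_diff) auto
    also have "(LINT v|sphere_unif. mix_density a \<delta> (v :: real^'n)) = 1"
      using mix_density_prob(1)[OF a(1) \<delta>] by simp
    finally show ?case
      using a by (simp add: field_simps)
  qed
  ultimately show ?thesis
    by (rule Lim_transform_eventually)
qed

end

section \<open>The limit of the dissipation\<close>

text \<open>Additive constants cancel in the differences of G, and scalars leave Bochner integrals
  without any integrability assumption.\<close>

lemma kac_form_affine: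
  "kac_form F (\<lambda>v. c * G v + b) = c * kac_form F (G :: real^('n::{finite,wellorder}) \<Rightarrow> real)"
proof -
  have eq: "indicator A \<theta> *\<^sub>R ((F v - F w) * (c * G v + b - (c * G w + b)) / (2 * pi)) =
     c * (indicator A \<theta> *\<^sub>R ((F v - F w) * (G v - G w) / (2 * pi)))" for A \<theta> v w
    by (simp add: algebra_simps diff_divide_distrib add_divide_distrib)
  show ?thesis
    unfolding kac_form_def set_lebesgue_integral_def eq case_prod_beta' integral_mult_right_zero
      sum_distrib_left[symmetric] by (rule mult.left_commute)
qed

lemma measurable_sphere_plane_rot_integral:
  fixes F G :: "real^'n::{finite,wellorder} \<Rightarrow> real"
  assumes [measurable]: "F \<in> borel_measurable borel" "G \<in> borel_measurable borel"
  shows "(\<lambda>\<theta>. LINT v|sphere_unif. F v * (G v - G (plane_rot i j \<theta> v))) \<in> borel_measurable borel"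
proof -
  interpret S: prob_space "sphere_unif :: (real^'n::_) measure"
    by (rule prob_space_sphere_unif)
  show ?thesis by measurable
qed

text \<open>The sum over pairs is brought inside the sphere integral because the limit for a single
  pair depends on S itself, while \<open>mix_density_integral_tendsto\<close> needs a limit
  depending on \<open>card S\<close>.\<close>

lemma kac_form_eq_rotation_integral:
  fixes F G :: "real^'n::{finite,wellorder} \<Rightarrow> real"
  assumes [measurable]: "F \<in> borel_measurable borel" "G \<in> borel_measurable borel"
    and F: "\<And>v. v \<in> kac_sphere \<Longrightarrow> \<bar>F v\<bar> \<le> A" and G: "\<And>v. v \<in> kac_sphere \<Longrightarrow> \<bar>G v\<bar> \<le> B"
  defines "Q \<equiv> \<lambda>\<theta>. LINT v|sphere_unif. F v * (\<Sum>(i, j)\<in>{(i, j). i < j}. G v - G (plane_rot i j \<theta> v))"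
  shows "kac_form F G = 1 / (real CARD('n) - 1) * 
    (LINT \<theta>|lborel. indicator {0..2*pi} \<theta> * ((Q \<theta> + Q (- \<theta>)) / (2 * pi)))"
proof -
  interpret S: prob_space "sphere_unif :: (real^'n::_) measure"
    by (rule prob_space_sphere_unif)
  define J where "J i j \<theta> = (LINT v|sphere_unif. F v * (G v - G (plane_rot i j \<theta> v)))" for i j \<theta>
  have [measurable]: "J i j \<in> borel_measurable borel" for i j
    unfolding J_def by (rule measurable_sphere_plane_rot_integral) measurable
  have i1: "integrable sphere_unif (\<lambda>v. F v * (G v - G (plane_rot i j \<theta> v)))" if "i < j" for i j \<theta>
    by (rule integrable_sphere_bounded[where C="A * (2 * B)"])
       (use F G that plane_rot_kac_sphere[of i j] in \<open>auto intro!: abs_mult_diff_le\<close>)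
  have Jb: "\<bar>J i j \<theta>\<bar> \<le> A * (2 * B)" if "i < j" for i j \<theta>
  proof -
    have "\<bar>J i j \<theta>\<bar> \<le> (LINT v|sphere_unif. \<bar>F v * (G v - G (plane_rot i j \<theta> v))\<bar>)"
      unfolding J_def by (rule integral_abs_bound)
    also have "\<dots> \<le> (LINT v|(sphere_unif :: (real^'n::_) measure). A * (2 * B))"
    proof (rule integral_mono_AE)
      show "AE v in sphere_unif. \<bar>F v * (G v - G (plane_rot i j \<theta> v))\<bar> \<le> A * (2 * B)"
        using AE_sphere_unif
        by eventually_elim (use F G that plane_rot_kac_sphere[of i j] in \<open>auto intro!: abs_mult_diff_le\<close>)
    qed (use i1[OF that] in auto)
    also have "\<dots> = A * (2 * B)" by (simp add: S.prob_space[simplified])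
    finally show ?thesis .
  qed
  have i2: "integrable lborel (\<lambda>\<theta>. indicator {0..2*pi} \<theta> * ((J i j \<theta> + J i j (- \<theta>)) / (2 * pi)))" if "i < j" for i j
  proof (rule Bochner_Integration.integrable_bound)
    show "integrable lborel (\<lambda>\<theta> :: real. A * (2 * B) * 2 * indicator {0..2*pi} \<theta>)"
      by (intro integrable_mult_right) simp
    show "AE \<theta> in lborel. norm (indicator {0..2*pi} \<theta> * ((J i j \<theta> + J i j (- \<theta>)) / (2 * pi)))
       \<le> norm (A * (2 * B) * 2 * indicator {0..2*pi} \<theta>)"
    proof (rule AE_I2)
      fix \<theta> :: real
      have "\<bar>J i j \<theta> + J i j (- \<theta>)\<bar> \<le> A * (2 * B) * 2"
        using Jb[OF that, of \<theta>] Jb[OF that, of "- \<theta>"] by linarith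
      moreover have "\<bar>J i j \<theta> + J i j (- \<theta>)\<bar> / (2 * pi) \<le> \<bar>J i j \<theta> + J i j (- \<theta>)\<bar> / 1"
        using pi_ge_two by (intro divide_left_mono) auto
      ultimately have "\<bar>(J i j \<theta> + J i j (- \<theta>)) / (2 * pi)\<bar> \<le> \<bar>A * (2 * B) * 2\<bar>"
        by (simp add: abs_divide)
      then show "norm (indicator {0..2*pi} \<theta> * ((J i j \<theta> + J i j (- \<theta>)) / (2 * pi)))
         \<le> norm (A * (2 * B) * 2 * indicator {0..2*pi} \<theta>)"
        by (simp add: indicator_def)
    qed
  qed measurable
  have Q: "Q \<theta> = (\<Sum>(i, j)\<in>{(i, j). i < j}. J i j \<theta>)" for \<theta>
    unfolding Q_def J_def sum_distrib_left case_prod_beta'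
    by (rule Bochner_Integration.integral_sum) (auto intro!: i1)
  have "kac_form F G = 1 / (real CARD('n) - 1) * (\<Sum>(i, j)\<in>{(i, j). i < j}. 
      (LINT \<theta>|lborel. indicator {0..2*pi} \<theta> * ((J i j \<theta> + J i j (- \<theta>)) / (2 * pi))))"
    unfolding kac_form_def J_def
  proof (intro arg_cong2[where f="(*)"] refl sum.cong)
    fix p :: "'n \<times> 'n" assume "p \<in> {(i, j). i < j}"
    then obtain i j where p: "p = (i, j)" "i \<noteq> j" by auto
    show "(case p of (i, j) \<Rightarrow> LINT v|sphere_unif. (LINT \<theta>:{0..2*pi}|lborel.
        (F v - F (plane_rot i j \<theta> v)) * (G v - G (plane_rot i j \<theta> v)) / (2 * pi))) =
      (case p of (i, j) \<Rightarrow> LINT \<theta>|lborel. indicator {0..2*pi} \<theta> *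
        (((LINT v|sphere_unif. F v * (G v - G (plane_rot i j \<theta> v))) +
          (LINT v|sphere_unif. F v * (G v - G (plane_rot i j (- \<theta>) v)))) / (2 * pi)))"
      unfolding p(1) prod.case by (rule kac_pair_symmetrize[OF p(2) _ _ F G]) measurable
  qed
  also have "(\<Sum>(i, j)\<in>{(i, j). i < j}. 
      (LINT \<theta>|lborel. indicator {0..2*pi} \<theta> * ((J i j \<theta> + J i j (- \<theta>)) / (2 * pi)))) = 
      (LINT \<theta>|lborel. (\<Sum>(i, j)\<in>{(i, j). i < j}. indicator {0..2*pi} \<theta> * ((J i j \<theta> + J i j (- \<theta>)) / (2 * pi))))"
    unfolding case_prod_beta' by (rule Bochner_Integration.integral_sum[symmetric]) (rule i2, auto)
  also have "\<dots> = (LINT \<theta>|lborel. indicator {0..2*pi} \<theta> * ((Q \<theta> + Q (- \<theta>)) / (2 * pi)))"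
    unfolding Q case_prod_beta' by (simp only: sum_distrib_left[symmetric] sum.distrib sum_divide_distrib[symmetric])
  finally show ?thesis .
qed

lemma AE_sin_cos_nonzero: "AE \<theta> :: real in lborel. sin \<theta> \<noteq> 0 \<and> cos \<theta> \<noteq> 0"
proof -
  have "{\<theta> :: real. sin \<theta> = 0 \<or> cos \<theta> = 0} \<subseteq> range (\<lambda>i :: int. of_int i * pi) \<union> range (\<lambda>i :: int. of_int i * pi + pi / 2)"
    by (auto simp: sin_zero_iff_int2 cos_zero_iff_int2)
  then have "countable {\<theta> :: real. sin \<theta> = 0 \<or> cos \<theta> = 0}"
    by (rule countable_subset) auto
  then have "{\<theta> :: real. sin \<theta> = 0 \<or> cos \<theta> = 0} \<in> null_sets lborel"
    by (rule countable_imp_null_set_lborel)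
  from AE_not_in[OF this] show ?thesis by simp
qed

context
  fixes \<delta> :: real
  assumes \<delta>: "0 < \<delta>" "\<delta> < 1"
begin

text \<open>The limit is taken first at a fixed generic angle, where it no longer depends on the
  angle, and then under the integral over angles.\<close>

lemma kac_form_tendsto:
  "((\<lambda>a. kac_form (mix_density a \<delta> :: real^'n::{finite,wellorder} \<Rightarrow> real) (\<lambda>v. ln (mix_density a \<delta> v)) / ln (1 / a)) \<longlongrightarrow>
     (\<Sum>k=1..CARD('n). real k * (real CARD('n) - real k) * K_prob CARD('n) \<delta> k) / (real CARD('n) - 1)) (at_right 0)"
proof -
  let ?pairs = "{(i, j). i < j} :: ('n \<times> 'n) set"
  let ?m = "real (card ?pairs)"
  define T where "T a \<theta> v = (\<Sum>(i, j)\<in>?pairs. mix_log_sum a \<delta> v - mix_log_sum a \<delta> (plane_rot i j \<theta> v))" for a \<theta> v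
  have T: "T a \<theta> v = (\<Sum>p\<in>?pairs. mix_log_sum a \<delta> v - mix_log_sum a \<delta> (plane_rot (fst p) (snd p) \<theta> v))" for a \<theta> v
    by (simp add: T_def case_prod_beta')
  define Q where "Q a \<theta> = (LINT v|sphere_unif. mix_density a \<delta> v * T a \<theta> v)" for a \<theta>
  \<comment> \<open>Each of the k (N - k) separated pairs contributes 1/2.\<close>
  define q where "q = (\<Sum>k=1..CARD('n). real k * (real CARD('n) - real k) / 2 * K_prob CARD('n) \<delta> k)"
  obtain C where C: "\<forall>\<^sub>F a in at_right 0. \<forall>v\<in>kac_sphere. \<bar>mix_log_sum a \<delta> (v :: real^'n::_)\<bar> \<le> C"
    using mix_log_sum_bounded[OF \<delta>] by blast
  interpret S: prob_space "sphere_unif :: (real^'n::_) measure"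
    by (rule prob_space_sphere_unif)
  have [measurable]: "(\<lambda>x. T a (g x) (f x)) \<in> borel_measurable M" 
    if [measurable]: "f \<in> borel_measurable M" "g \<in> borel_measurable M" for a f g and M :: "'z measure"
    unfolding T_def case_prod_beta' by measurable
  have Tm [measurable]: "T a \<theta> \<in> borel_measurable borel" for a \<theta>
    unfolding T_def case_prod_beta' by measurable
  have [measurable]: "Q a \<in> borel_measurable borel" for a
    unfolding Q_def T_def case_prod_beta' by measurable
  have Tb: "\<forall>\<^sub>F a in at_right 0. \<forall>\<theta>. \<forall>v\<in>kac_sphere. \<bar>T a \<theta> v\<bar> \<le> ?m * (2 * C)"
    using C
  proof eventually_elim
    case (elim a)
    show ?case
    proof (intro allI ballI)
      fix \<theta> and v :: "real^'n::_" assume v: "v \<in> kac_sphere"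
      have "\<bar>T a \<theta> v\<bar> \<le> (\<Sum>p\<in>?pairs. 2 * C)"
        unfolding T
      proof (rule order_trans[OF sum_abs sum_mono])
        fix p assume "p \<in> ?pairs"
        then have "plane_rot (fst p) (snd p) \<theta> v \<in> kac_sphere"
          using v plane_rot_kac_sphere[of "fst p" "snd p"] by auto
        with elim v have "\<bar>mix_log_sum a \<delta> v\<bar> \<le> C" "\<bar>mix_log_sum a \<delta> (plane_rot (fst p) (snd p) \<theta> v)\<bar> \<le> C"
          by auto
        then show "\<bar>mix_log_sum a \<delta> v - mix_log_sum a \<delta> (plane_rot (fst p) (snd p) \<theta> v)\<bar> \<le> 2 * C"
          by linarith
      qed
      then show "\<bar>T a \<theta> v\<bar> \<le> ?m * (2 * C)" by simp
    qed
  qed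
  have Qlim: "((\<lambda>a. Q a \<theta>) \<longlongrightarrow> q) (at_right 0)" if \<theta>: "sin \<theta> \<noteq> 0" "cos \<theta> \<noteq> 0" for \<theta>
    unfolding Q_def q_def
  proof (rule mix_density_integral_tendsto[OF \<delta> Tm])
    show "\<forall>\<^sub>F a in at_right 0. \<forall>v\<in>kac_sphere. \<bar>T a \<theta> v\<bar> \<le> ?m * (2 * C)"
      using Tb by eventually_elim auto
    fix S :: "'n set" assume S: "S \<noteq> {}"
    have lim: "AE x :: real^'n::_ in lborel. \<forall>p\<in>?pairs.
      ((\<lambda>a. mix_log_sum a \<delta> (shrink_proj S a x) - mix_log_sum a \<delta> (plane_rot (fst p) (snd p) \<theta> (shrink_proj S a x))) \<longlongrightarrow> 
         (if (fst p \<in> S) \<noteq> (snd p \<in> S) then 1 / 2 else 0)) (at_right 0)"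
      by (intro AE_finite_allI mix_log_sum_diff_tendsto[OF \<delta> S _ \<theta>]) auto
    have e: "(\<Sum>p\<in>?pairs. if (fst p \<in> S) \<noteq> (snd p \<in> S) then 1 / 2 else 0 :: real) = 
       real (card S) * (real CARD('n) - real (card S)) / 2"
    proof -
      have "(\<Sum>p\<in>?pairs. if (fst p \<in> S) \<noteq> (snd p \<in> S) then 1 / 2 else 0 :: real) = 
         (\<Sum>p\<in>{(i, j). i < j \<and> (i \<in> S) \<noteq> (j \<in> S)}. 1 / 2)"
        by (intro sum.mono_neutral_cong_right) auto
      also have "\<dots> = real (card S * (CARD('n) - card S)) / 2"
        by (simp only: sum_constant card_separated_pairs)
      finally show ?thesis by (simp add: of_nat_diff card_mono)
    qed
    show "AE x in lborel. ((\<lambda>a. T a \<theta> (shrink_proj S a x)) \<longlongrightarrow> 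
        real (card S) * (real CARD('n) - real (card S)) / 2) (at_right 0)"
      unfolding T e[symmetric] using lim by eventually_elim (intro tendsto_sum, blast)
  qed
  \<comment> \<open>The density has mass 1, so the bound on the increments passes to Q uniformly in
    a and the angle, although the bound A on the density depends on a.\<close>
  have Qb: "\<forall>\<^sub>F a in at_right 0. \<forall>\<theta>. \<bar>Q a \<theta>\<bar> \<le> ?m * (2 * C)"
    using Tb eventually_at_right_0_less[OF zero_less_one]
  proof eventually_elim
    case (elim a)
    then have a: "0 < a" "a < 1" by auto
    obtain A where A: "\<And>v :: real^'n::_. \<bar>mix_density a \<delta> v\<bar> \<le> A"
      using mix_density_bounded[OF \<delta> a] by blast
    have i1: "integrable sphere_unif (mix_density a \<delta> :: real^'n::_ \<Rightarrow> real)"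
      by (rule integrable_sphere_bounded[where C=A]) (use A in auto)
    have pos: "mix_density a \<delta> (v :: real^'n::_) > 0" for v
      by (rule mix_density_prob) (use a \<delta> in auto)
    show ?case
    proof
      fix \<theta>
      have le: "AE v in sphere_unif. \<bar>mix_density a \<delta> v * T a \<theta> v\<bar> \<le> mix_density a \<delta> v * (?m * (2 * C))"
        using AE_sphere_unif
        by eventually_elim (use elim pos in \<open>auto simp: abs_mult less_imp_le intro!: mult_left_mono\<close>)
      have i2: "integrable sphere_unif (\<lambda>v. mix_density a \<delta> v * T a \<theta> v)"
        by (rule Bochner_Integration.integrable_bound[of _ "\<lambda>v. mix_density a \<delta> v * (?m * (2 * C))"])
           (use le i1 in \<open>auto elim!: eventually_mono intro: order_trans[OF _ abs_ge_self]\<close>)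
      have "\<bar>Q a \<theta>\<bar> \<le> (LINT v|sphere_unif. \<bar>mix_density a \<delta> v * T a \<theta> v\<bar>)"
        unfolding Q_def by (rule integral_abs_bound)
      also have "\<dots> \<le> (LINT v|(sphere_unif :: (real^'n::_) measure). mix_density a \<delta> v * (?m * (2 * C)))"
        using i1 i2 le by (intro integral_mono_AE) auto
      also have "\<dots> = (LINT v|(sphere_unif :: (real^'n::_) measure). mix_density a \<delta> v) * (?m * (2 * C))"
        by (rule integral_mult_left_zero)
      also have "\<dots> = ?m * (2 * C)"
        using mix_density_prob(1)[OF a(1) \<delta>, where 'n='n] by simp
      finally show "\<bar>Q a \<theta>\<bar> \<le> ?m * (2 * C)" .
    qed
  qed
  have "((\<lambda>a. LINT \<theta>|lborel. indicator {0..2*pi} \<theta> * ((Q a \<theta> + Q a (- \<theta>)) / (2 * pi))) \<longlongrightarrow> 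
     (LINT \<theta>|lborel. indicator {0..2*pi} \<theta> * ((q + q) / (2 * pi)))) (at_right 0)"
  proof (rule integral_dominated_convergence_at_right_0)
    show "integrable lborel (\<lambda>\<theta> :: real. 2 * (?m * (2 * C)) / (2 * pi) * indicator {0..2*pi} \<theta>)"
      by (intro integrable_mult_right) simp
    show "AE \<theta> in lborel. ((\<lambda>a. indicator {0..2*pi} \<theta> * ((Q a \<theta> + Q a (- \<theta>)) / (2 * pi))) \<longlongrightarrow> 
       indicator {0..2*pi} \<theta> * ((q + q) / (2 * pi))) (at_right 0)"
      \<comment> \<open>The opposite of a generic angle is generic too, so both terms converge to
        q.\<close>
      using AE_sin_cos_nonzero by eventually_elim (intro tendsto_intros Qlim, auto)
    show "\<forall>\<^sub>F a in at_right 0. AE \<theta> in lborel. norm (indicator {0..2*pi} \<theta> * ((Q a \<theta> + Q a (- \<theta>)) / (2 * pi)))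
       \<le> 2 * (?m * (2 * C)) / (2 * pi) * indicator {0..2*pi} \<theta>"
      using Qb
    proof eventually_elim
      case (elim a)
      show ?case
      proof (rule AE_I2)
        fix \<theta> :: real
        have "\<bar>Q a \<theta> + Q a (- \<theta>)\<bar> \<le> 2 * (?m * (2 * C))"
          using elim[rule_format, of \<theta>] elim[rule_format, of "- \<theta>"] by linarith
        then have "\<bar>Q a \<theta> + Q a (- \<theta>)\<bar> / (2 * pi) \<le> 2 * (?m * (2 * C)) / (2 * pi)"
          by (rule divide_right_mono) simp
        then have "\<bar>Q a \<theta> + Q a (- \<theta>)\<bar> / (2 * pi) * indicator {0..2*pi} \<theta>
            \<le> 2 * (?m * (2 * C)) / (2 * pi) * indicator {0..2*pi} \<theta>"
          by (rule mult_right_mono) simp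
        then show "norm (indicator {0..2*pi} \<theta> * ((Q a \<theta> + Q a (- \<theta>)) / (2 * pi)))
          \<le> 2 * (?m * (2 * C)) / (2 * pi) * indicator {0..2*pi} \<theta>"
          unfolding real_norm_def abs_mult abs_divide by (simp add: mult.commute)
      qed
    qed
  qed measurable
  \<comment> \<open>The interval has length 2 pi, so the average is q + q; the doubling from the
    symmetrization removes the 1/2 in q.\<close>
  also have "(LINT \<theta>|lborel. indicator {0..2*pi} \<theta> * ((q + q) / (2 * pi))) = 2 * q"
    by simp
  finally have "((\<lambda>a. 1 / (real CARD('n) - 1) * (LINT \<theta>|lborel. indicator {0..2*pi} \<theta> * ((Q a \<theta> + Q a (- \<theta>)) / (2 * pi)))) \<longlongrightarrow> 
     1 / (real CARD('n) - 1) * (2 * q)) (at_right 0)"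
    by (rule tendsto_mult_left)
  also have "1 / (real CARD('n) - 1) * (2 * q) = 
      (\<Sum>k=1..CARD('n). real k * (real CARD('n) - real k) * K_prob CARD('n) \<delta> k) / (real CARD('n) - 1)"
    unfolding q_def by (simp add: sum_distrib_left sum_divide_distrib)
  finally show ?thesis
  proof (rule Lim_transform_eventually)
    show "\<forall>\<^sub>F a in at_right 0. 1 / (real CARD('n) - 1) * (LINT \<theta>|lborel. indicator {0..2*pi} \<theta> * ((Q a \<theta> + Q a (- \<theta>)) / (2 * pi))) =
       kac_form (mix_density a \<delta> :: real^'n::{finite,wellorder} \<Rightarrow> real) (\<lambda>v. ln (mix_density a \<delta> v)) / ln (1 / a)"
      using C eventually_at_right_0_less[OF zero_less_one]
    proof eventually_elim
      case (elim a)
      then have a: "0 < a" "a < 1" by auto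
      obtain A where A: "\<And>v :: real^'n::_. \<bar>mix_density a \<delta> v\<bar> \<le> A"
        using mix_density_bounded[OF \<delta> a] by blast
      define z where "z = ln (LINT w|(sphere_unif :: (real^'n::_) measure). mix_prod a \<delta> w)"
      have "kac_form (mix_density a \<delta> :: real^'n::_ \<Rightarrow> real) (\<lambda>v. ln (mix_density a \<delta> v)) =
         kac_form (mix_density a \<delta> :: real^'n::_ \<Rightarrow> real) (\<lambda>v. ln (1 / a) * mix_log_sum a \<delta> v + (- z))"
        unfolding ln_mix_density[OF \<delta> a] z_def by simp
      also have "\<dots> = ln (1 / a) * kac_form (mix_density a \<delta> :: real^'n::_ \<Rightarrow> real) (mix_log_sum a \<delta>)"
        by (rule kac_form_affine)
      also have "kac_form (mix_density a \<delta> :: real^'n::_ \<Rightarrow> real) (mix_log_sum a \<delta>) = 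
         1 / (real CARD('n) - 1) * (LINT \<theta>|lborel. indicator {0..2*pi} \<theta> * ((Q a \<theta> + Q a (- \<theta>)) / (2 * pi)))"
        unfolding Q_def T_def by (rule kac_form_eq_rotation_integral[where A=A and B=C]) (use A elim in auto)
      finally show ?case using a by simp
    qed
  qed
qed

end

section \<open>From sums to expectations of K\<close>

text \<open>The law is prescribed on I only. As these probabilities already sum to 1, K lies in I
  almost surely, so \<open>g (K \<omega>)\<close> is almost surely a finite combination of
  indicators.\<close>

lemma expectation_finite_law:
  fixes K :: "'w \<Rightarrow> nat" and g :: "nat \<Rightarrow> real"
  assumes M: "prob_space M" and K: "K \<in> measurable M (count_space UNIV)" and I: "finite I"
    and law: "\<And>k. k \<in> I \<Longrightarrow> measure M {\<omega> \<in> space M. K \<omega> = k} = p k" and sum: "(\<Sum>k\<in>I. p k) = 1"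
  shows "prob_space.expectation M (\<lambda>\<omega>. g (K \<omega>)) = (\<Sum>k\<in>I. g k * p k)"
proof -
  interpret prob_space M by fact
  note K [measurable]
  define E where "E k = {\<omega> \<in> space M. K \<omega> = k}" for k
  have E [measurable]: "E k \<in> sets M" for k
    unfolding E_def by measurable
  have "prob (\<Union>k\<in>I. E k) = (\<Sum>k\<in>I. prob (E k))"
    by (rule finite_measure_finite_Union) (auto simp: I disjoint_family_on_def E_def)
  also have "\<dots> = 1"
    using law sum by (simp add: E_def)
  finally have "AE \<omega> in M. \<omega> \<in> (\<Union>k\<in>I. E k)"
    by (subst AE_in_set_eq_1) (use I in auto)
  then have "AE \<omega> in M. g (K \<omega>) = (\<Sum>k\<in>I. g k * indicator (E k) \<omega>)"
  proof (eventually_elim)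
    case (elim \<omega>)
    then have "K \<omega> \<in> I" "\<omega> \<in> space M" by (auto simp: E_def)
    then have "(\<Sum>k\<in>I. g k * indicator (E k) \<omega>) = (\<Sum>k\<in>I. if k = K \<omega> then g k else 0)"
      by (intro sum.cong) (auto simp: E_def indicator_def)
    then show ?case using I \<open>K \<omega> \<in> I\<close> by simp
  qed
  then have "expectation (\<lambda>\<omega>. g (K \<omega>)) = expectation (\<lambda>\<omega>. \<Sum>k\<in>I. g k * indicator (E k) \<omega>)"
    by (intro integral_cong_AE) auto
  also have "\<dots> = (\<Sum>k\<in>I. g k * prob (E k))"
    by (subst Bochner_Integration.integral_sum) (auto simp: emeasure_eq_measure)
  also have "\<dots> = (\<Sum>k\<in>I. g k * p k)"
    using law by (simp add: E_def)
  finally show ?thesis .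
qed

theorem proposition1p2:
  fixes \<delta> :: real and M :: "'w measure" and K :: "'w \<Rightarrow> nat"
  assumes N: "CARD('n::{finite,wellorder}) \<ge> 2"
    and \<delta>: "0 < \<delta>" "\<delta> < 1"
    and M: "prob_space M"
    and K: "K \<in> measurable M (count_space UNIV)"
    and law_K: "\<And>k. k \<in> {1..CARD('n)} \<Longrightarrow>
                  measure M {\<omega> \<in> space M. K \<omega> = k} = K_prob CARD('n) \<delta> k"
  shows "((\<lambda>a. sphere_entropy (mix_density a \<delta> :: real^'n::_ \<Rightarrow> real) / ln (1 / a)) \<longlongrightarrow>
            (real CARD('n) - prob_space.expectation M (\<lambda>\<omega>. real (K \<omega>))) / 2) (at_right 0)
       \<and> ((\<lambda>a. kac_form (mix_density a \<delta> :: real^'n::_ \<Rightarrow> real) (\<lambda>v. ln (mix_density a \<delta> v)) / ln (1 / a)) \<longlongrightarrow>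
            prob_space.expectation M (\<lambda>\<omega>. real (K \<omega>) * (real CARD('n) - real (K \<omega>)))
              / (real CARD('n) - 1)) (at_right 0)"
proof -
  let ?N = "CARD('n)"
  have sum1: "(\<Sum>k=1..?N. K_prob ?N \<delta> k) = 1"
    by (rule K_prob_distribution(2)[OF _ \<delta>]) (use N in simp)
  have E: "prob_space.expectation M (\<lambda>\<omega>. g (K \<omega>)) = (\<Sum>k=1..?N. g k * K_prob ?N \<delta> k)" for g
    by (rule expectation_finite_law[OF M K _ law_K sum1]) auto
  have "(\<Sum>k=1..?N. (real ?N - real k) / 2 * K_prob ?N \<delta> k) =
      (real ?N * (\<Sum>k=1..?N. K_prob ?N \<delta> k) - (\<Sum>k=1..?N. real k * K_prob ?N \<delta> k)) / 2"
    by (simp add: sum_distrib_left sum_subtractf[symmetric] sum_divide_distrib left_diff_distrib)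
  also have "\<dots> = (real ?N - prob_space.expectation M (\<lambda>\<omega>. real (K \<omega>))) / 2"
    by (simp only: sum1 E[of real] mult_1_right)
  finally show ?thesis
    using sphere_entropy_tendsto[OF \<delta>, where 'n='n] kac_form_tendsto[OF \<delta>, where 'n='n]
    by (simp only: E[of "\<lambda>k. real k * (real ?N - real k)"])
qed

end
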